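(* Let $J_0$ be the zeroth Bessel function of the first kind. (i) Let $ABC$ be a nondegenerate triangle in $\mathbb{R}^2$ and put $\omega = |AB|/|AC|$. Suppose that $$\min_{t\ge 0}\bigl(J_0(t)+J_0(\omega t)\bigr)\ge -0.5972406 .$$ Then for any measurable coloring of $\mathbb{R}^2$ into two colors there is a monochromatic triangle congruent to $ABC$. (ii) Let $\kappa>0$ be a real number such that $$\min_{t\ge 0}\bigl(J_0(t)+J_0(\kappa t)+J_0((1+\kappa)t)\bigr)>-1 .$$ Then for any measurable coloring of $\mathbb{R}^2$ into two colors there is a monochromatic collinear triple $\{x,y,z\}$ of points with $y\in[x,z]$ and $\|z-y\|/\|y-x\|=\kappa$ (in particular $y\ne x$).
   Context: $\|\cdot\|$ is the Euclidean norm on $\mathbb{R}^2$ and $[x,z]$ is the closed segment with endpoints $x,z$. A measurable coloring of $\mathbb{R}^2$ into two colors is a partition of $\mathbb{R}^2$ into two disjoint Lebesgue measurable sets $C_1,C_2$ (the colors). A set of points (for instance the three vertices of a triangle) is monochromatic if all its points belong to the same color. The zeroth Bessel function of the first kind is $J_0(z)=\sum_{k=0}^{\infty}\frac{(-1)^k (z/2)^{2k}}{(k!)^2}$. *)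

theory Defs
  imports "HOL-Analysis.Analysis"
begin

definition J0 :: "real \<Rightarrow> real" where
  "J0 z = (\<Sum>k. (-1) ^ k * (z / 2) ^ (2 * k) / (fact k)\<^sup>2)"

(* A color may be empty. *)
definition measurable_coloring :: "(real^2) set \<Rightarrow> (real^2) set \<Rightarrow> bool" where
  "measurable_coloring C1 C2 \<longleftrightarrow>
     C1 \<in> sets lebesgue \<and> C2 \<in> sets lebesgue \<and> C1 \<union> C2 = UNIV \<and> C1 \<inter> C2 = {}"

definition monochromatic :: "(real^2) set \<Rightarrow> (real^2) set \<Rightarrow> (real^2) set \<Rightarrow> bool" where
  "monochromatic C1 C2 S \<longleftrightarrow> S \<subseteq> C1 \<or> S \<subseteq> C2"

(* Congruence of figures; orientation-reversing isometries are allowed.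
   A triangle is represented by its set of vertices. *)
definition congruent_sets :: "(real^2) set \<Rightarrow> (real^2) set \<Rightarrow> bool" where
  "congruent_sets S T \<longleftrightarrow>
     (\<exists>f. (\<forall>x y. dist (f x) (f y) = dist x y) \<and> f ` S = T)"

end

theory Submission
  imports Defs "HOL-Probability.Characteristic_Functions" "HOL-Probability.Sinc_Integral"
begin

text \<open>
  Let \<open>f\<close> be \<open>1\<close> on one color and \<open>- 1\<close> on the other. Three points carry the same color or the sum of the
  three pairwise products of the values of \<open>f\<close> is \<open>- 1\<close>. So if a coloring has no monochromatic copy of a triangle
  with side vectors \<open>b\<close>, \<open>c\<close>, \<open>c - b\<close>, then the autocorrelation of \<open>f\<close>, taken at these three vectors, sums to
  \<open>- 1\<close> times its value at \<open>0\<close>, and this remains true after every rotation of the triangle. The autocorrelation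
  is of positive type: it is a superposition, with positive weights, of plane waves. Averaging a plane wave
  of frequency \<open>\<xi>\<close> over all rotations of a vector of length \<open>r\<close> gives \<open>J0 (r * norm \<xi>)\<close>. The averaged sum
  is therefore at least the minimum over \<open>t \<ge> 0\<close> of the sum of \<open>J0\<close> at the three side lengths times \<open>t\<close>, multiplied by the
  autocorrelation at \<open>0\<close>. If that minimum exceeds \<open>- 1\<close>, there is a contradiction. The lemma
  \<open>monochromatic_rotated_copy\<close> says this for arbitrary vectors \<open>b\<close> and \<open>c\<close>.

  The collinear triples are the case of a degenerate triangle with sides \<open>1\<close>, \<open>\<kappa>\<close>, \<open>1 + \<kappa>\<close>. For a proper
  triangle the assumption bounds the contribution of two sides by \<open>- 0.5972406\<close>, and the third contributes at
  least the global minimum of \<open>J0\<close>, about \<open>- 0.4027593957\<close> (lemma \<open>J0_ge\<close>); the constant in the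
  statement is just large enough for the sum to stay above \<open>- 1\<close>.

  As \<open>f\<close> is not integrable, it is multiplied by a weight \<open>exp (- \<delta> * norm x)\<close> with small \<open>\<delta>\<close>, which is almost
  invariant under the translations that occur (lemma \<open>exp_weight_translate\<close>). For the
  positivity, the correlation is blurred by a narrow Gaussian, whose Fourier transform is explicit, and its
  representation by plane waves becomes an instance of Fubini's theorem (lemma \<open>smoothed_correlation_spectral\<close>); the blurring is
  then removed, first for continuous functions and by approximation for all measurable ones (lemma
  \<open>rotation_average_correlation_ge\<close>).
\<close>

section \<open>The Bessel function as a power series in the squared argument\<close>

definition bessel_coeff :: "nat \<Rightarrow> real" where
  "bessel_coeff k = (-1) ^ k / (fact k)\<^sup>2"

definition bessel_series :: "real \<Rightarrow> real" where
  "bessel_series x = (\<Sum>k. bessel_coeff k * x ^ k)"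

definition bessel_series' :: "real \<Rightarrow> real" where
  "bessel_series' x = (\<Sum>k. diffs bessel_coeff k * x ^ k)"

definition bessel_series'' :: "real \<Rightarrow> real" where
  "bessel_series'' x = (\<Sum>k. diffs (diffs bessel_coeff) k * x ^ k)"

lemma J0_eq_bessel_series: "J0 z = bessel_series (z\<^sup>2 / 4)"
proof -
  have "(-1) ^ k * (z / 2) ^ (2 * k) / (fact k)\<^sup>2 = bessel_coeff k * (z\<^sup>2 / 4) ^ k" for k
    by (simp add: bessel_coeff_def power_mult power_divide)
  then show ?thesis by (simp add: J0_def bessel_series_def)
qed

lemma diffs_bessel_coeff:
  "diffs bessel_coeff k = - ((-1) ^ k / (fact k * fact (Suc k)))"
proof -
  have "a * (s / (a * F)\<^sup>2) = s / (F * (a * F))" if "a \<noteq> 0" for a F s :: real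
    using that by (simp add: power2_eq_square)
  from this[of "real (Suc k)" "(-1) ^ Suc k" "fact k"] show ?thesis
    unfolding diffs_def bessel_coeff_def fact_Suc[of k] by (simp del: of_nat_Suc)
qed

lemma diffs_diffs_bessel_coeff:
  "diffs (diffs bessel_coeff) k = (-1) ^ k / (fact k * fact (Suc (Suc k)))"
proof -
  have "a * - (s / ((a * F) * G)) = - s / (F * G)" if "a \<noteq> 0" for a F G s :: real
    using that by simp
  from this[of "real (Suc k)" "(-1) ^ Suc k" "fact k" "fact (Suc (Suc k))"] show ?thesis
    unfolding diffs_def[of "diffs bessel_coeff"] diffs_bessel_coeff fact_Suc[of k]
    by (simp del: of_nat_Suc fact_Suc)
qed

lemma summable_bessel_coeff: "summable (\<lambda>k. bessel_coeff k * x ^ k)"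
proof (rule summable_comparison_test')
  show "summable (\<lambda>k. \<bar>x\<bar> ^ k / fact k)"
    using summable_exp[of "\<bar>x\<bar>"] by (simp add: field_simps)
  show "norm (bessel_coeff k * x ^ k) \<le> \<bar>x\<bar> ^ k / fact k" for k
  proof -
    have "(1::real) * fact k \<le> fact k * fact k" by (intro mult_right_mono fact_ge_1) auto
    then have "1 / (fact k)\<^sup>2 \<le> (1::real) / fact k"
      by (intro divide_left_mono) (auto simp: power2_eq_square)
    then have "\<bar>x\<bar> ^ k * (1 / (fact k)\<^sup>2) \<le> \<bar>x\<bar> ^ k * (1 / fact k)"
      by (intro mult_left_mono) auto
    then show ?thesis by (simp add: bessel_coeff_def abs_mult power_abs)
  qed
qed

lemma summable_diffs_bessel_coeff:
  "summable (\<lambda>k. diffs bessel_coeff k * x ^ k)"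
  "summable (\<lambda>k. diffs (diffs bessel_coeff) k * x ^ k)"
  using summable_bessel_coeff termdiff_converges_all by blast+

lemma has_field_derivative_bessel_series:
  "(bessel_series has_field_derivative bessel_series' x) (at x)"
  "(bessel_series' has_field_derivative bessel_series'' x) (at x)"
  unfolding bessel_series_def[abs_def] bessel_series'_def[abs_def] bessel_series''_def
  using termdiffs_strong_converges_everywhere[OF summable_bessel_coeff]
    termdiffs_strong_converges_everywhere[OF summable_diffs_bessel_coeff(1)] by auto

text \<open>Bessel's equation in the variable \<open>x = z\<^sup>2 / 4\<close>, obtained by comparing coefficients; it drives the
energy estimate below.\<close>

lemma bessel_series_ode:
  "x * bessel_series'' x + bessel_series' x + bessel_series x = 0"
proof -
  have coeff: "diffs (diffs bessel_coeff) k + (diffs bessel_coeff (Suc k) + bessel_coeff (Suc k)) = 0" for k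
  proof -
    have f: "fact (Suc (Suc k)) = (real k + 2) * fact (Suc k)" "fact (Suc k) = (real k + 1) * fact k"
      by (simp_all add: algebra_simps)
    show ?thesis
      unfolding diffs_diffs_bessel_coeff diffs_bessel_coeff bessel_coeff_def f power2_eq_square
      by (simp add: divide_simps) (simp add: algebra_simps)
  qed
  let ?e = "\<lambda>k. diffs bessel_coeff k + bessel_coeff k"
  have s: "summable (\<lambda>k. ?e k * x ^ k)"
    using summable_add[OF summable_diffs_bessel_coeff(1) summable_bessel_coeff]
    by (simp add: algebra_simps)
  have "bessel_series' x + bessel_series x = (\<Sum>k. ?e k * x ^ k)"
    unfolding bessel_series'_def bessel_series_def
    by (subst suminf_add[OF summable_diffs_bessel_coeff(1) summable_bessel_coeff])
       (simp add: algebra_simps)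
  also have "\<dots> = (\<Sum>k. ?e (Suc k) * x ^ Suc k)"
    by (subst suminf_split_head[OF s]) (simp add: diffs_bessel_coeff bessel_coeff_def)
  also have "\<dots> = (\<Sum>k. - x * (diffs (diffs bessel_coeff) k * x ^ k))"
  proof (rule suminf_cong)
    fix k
    have "?e (Suc k) = - diffs (diffs bessel_coeff) k" using coeff[of k] by linarith
    then show "?e (Suc k) * x ^ Suc k = - x * (diffs (diffs bessel_coeff) k * x ^ k)" by simp
  qed
  also have "\<dots> = - x * bessel_series'' x"
    unfolding bessel_series''_def by (rule suminf_mult[OF summable_diffs_bessel_coeff(2)])
  finally show ?thesis by simp
qed

section \<open>The minimum of the Bessel function\<close>

text \<open>Leibniz' estimate for a series whose terms alternate from the start but decrease only from an even
index on: the tail starts with a nonnegative term, so it lies between \<open>0\<close> and that term.\<close>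

lemma alternating_series_bounds:
  fixes a :: "nat \<Rightarrow> real"
  assumes sm: "summable (\<lambda>k. (-1) ^ k * a k)" and ev: "even N"
    and nonneg: "\<And>k. k \<ge> N \<Longrightarrow> a k \<ge> 0"
    and decr: "\<And>k. k \<ge> N \<Longrightarrow> a (Suc k) \<le> a k"
  shows "(\<Sum>k<N. (-1) ^ k * a k) \<le> (\<Sum>k. (-1) ^ k * a k)"
    and "(\<Sum>k. (-1) ^ k * a k) \<le> (\<Sum>k<Suc N. (-1) ^ k * a k)"
proof -
  let ?b = "\<lambda>k. a (k + N)"
  have "(\<lambda>k. \<bar>(-1) ^ k * a k\<bar>) \<longlonglongrightarrow> 0"
    using summable_LIMSEQ_zero[OF sm] tendsto_rabs_zero by blast
  then have "(\<lambda>k. \<bar>a (k + N)\<bar>) \<longlonglongrightarrow> 0"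
    using LIMSEQ_ignore_initial_segment[of "\<lambda>k. \<bar>a k\<bar>" 0 N] by (simp add: abs_mult)
  then have b0: "?b \<longlonglongrightarrow> 0" by (simp add: tendsto_rabs_zero_iff)
  have "(\<Sum>k. (-1) ^ k * a k) = (\<Sum>k. (-1) ^ (k + N) * a (k + N)) + (\<Sum>k<N. (-1) ^ k * a k)"
    by (rule suminf_split_initial_segment[OF sm])
  also have "(\<lambda>k. (-1) ^ (k + N) * a (k + N)) = (\<lambda>k. (-1) ^ k * ?b k)"
    using ev by (simp add: power_add)
  finally have eq: "(\<Sum>k. (-1) ^ k * a k) = (\<Sum>k. (-1) ^ k * ?b k) + (\<Sum>k<N. (-1) ^ k * a k)" .
  have nn: "?b k \<ge> 0" and dd: "?b (Suc k) \<le> ?b k" for k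
    using nonneg[of "k + N"] decr[of "k + N"] by auto
  note L = summable_Leibniz'[OF b0 nn dd]
  have "0 \<le> (\<Sum>k. (-1) ^ k * ?b k)" "(\<Sum>k. (-1) ^ k * ?b k) \<le> a N"
    using L(2)[of 0] L(4)[of 0] by auto
  with eq ev show "(\<Sum>k<N. (-1) ^ k * a k) \<le> (\<Sum>k. (-1) ^ k * a k)"
    "(\<Sum>k. (-1) ^ k * a k) \<le> (\<Sum>k<Suc N. (-1) ^ k * a k)" by auto
qed

lemma factorial_terms_decreasing:
  fixes x :: real
  assumes "0 \<le> x" "x \<le> 4" "k \<ge> 2"
  shows "x ^ Suc k / (fact (Suc k) * fact (Suc k + j)) \<le> x ^ k / (fact k * fact (k + j))"
proof -
  have f: "fact (Suc k) * fact (Suc k + j) = (real k + 1) * (real k + j + 1) * (fact k * fact (k + j))"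
    by (simp add: algebra_simps)
  have "x \<le> (real k + 1) * (real k + j + 1)"
    using assms mult_mono[of 3 "real k + 1" 3 "real k + j + 1"] by simp
  moreover have "0 < (real k + 1) * (real k + j + 1)" by simp
  ultimately have "x / ((real k + 1) * (real k + j + 1)) \<le> 1" by (simp only: divide_le_eq_1_pos)
  then have "x / ((real k + 1) * (real k + j + 1)) * (x ^ k / (fact k * fact (k + j)))
      \<le> 1 * (x ^ k / (fact k * fact (k + j)))"
    using assms by (intro mult_right_mono) auto
  also have "x / ((real k + 1) * (real k + j + 1)) * (x ^ k / (fact k * fact (k + j)))
      = x ^ Suc k / (fact (Suc k) * fact (Suc k + j))"
    unfolding f by simp
  finally show ?thesis by simp
qed

lemma bessel_series_bounds:
  assumes "0 \<le> x" "x \<le> 4" "even N" "N \<ge> 2"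
  shows "(\<Sum>k<N. (-1) ^ k * (x ^ k / (fact k * fact k))) \<le> bessel_series x"
    "bessel_series x \<le> (\<Sum>k<Suc N. (-1) ^ k * (x ^ k / (fact k * fact k)))"
    "(\<Sum>k<N. (-1) ^ k * (x ^ k / (fact k * fact (k + 1)))) \<le> - bessel_series' x"
    "- bessel_series' x \<le> (\<Sum>k<Suc N. (-1) ^ k * (x ^ k / (fact k * fact (k + 1))))"
    "(\<Sum>k<N. (-1) ^ k * (x ^ k / (fact k * fact (k + 2)))) \<le> bessel_series'' x"
proof -
  note decr = factorial_terms_decreasing[OF assms(1,2)]
  have e: "bessel_series x = (\<Sum>k. (-1) ^ k * (x ^ k / (fact k * fact k)))"
    "summable (\<lambda>k. (-1) ^ k * (x ^ k / (fact k * fact k)))"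
    using summable_bessel_coeff[of x]
    by (simp_all add: bessel_series_def bessel_coeff_def power2_eq_square)
  show "(\<Sum>k<N. (-1) ^ k * (x ^ k / (fact k * fact k))) \<le> bessel_series x"
    "bessel_series x \<le> (\<Sum>k<Suc N. (-1) ^ k * (x ^ k / (fact k * fact k)))"
    unfolding e(1) using assms decr[of _ 0]
    by (intro alternating_series_bounds[OF e(2) assms(3)]; auto)+
  have e1: "- bessel_series' x = (\<Sum>k. (-1) ^ k * (x ^ k / (fact k * fact (k + 1))))"
    "summable (\<lambda>k. (-1) ^ k * (x ^ k / (fact k * fact (k + 1))))"
    using summable_diffs_bessel_coeff(1)[of x, THEN summable_minus]
    by (simp_all add: bessel_series'_def diffs_bessel_coeff suminf_minus summable_diffs_bessel_coeff)
  show "(\<Sum>k<N. (-1) ^ k * (x ^ k / (fact k * fact (k + 1)))) \<le> - bessel_series' x"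
    "- bessel_series' x \<le> (\<Sum>k<Suc N. (-1) ^ k * (x ^ k / (fact k * fact (k + 1))))"
    unfolding e1(1) using assms decr[of _ 1]
    by (intro alternating_series_bounds[OF e1(2) assms(3)]; auto)+
  have e2: "bessel_series'' x = (\<Sum>k. (-1) ^ k * (x ^ k / (fact k * fact (k + 2))))"
    "summable (\<lambda>k. (-1) ^ k * (x ^ k / (fact k * fact (k + 2))))"
    using summable_diffs_bessel_coeff(2)[of x]
    by (simp_all add: bessel_series''_def diffs_diffs_bessel_coeff)
  show "(\<Sum>k<N. (-1) ^ k * (x ^ k / (fact k * fact (k + 2)))) \<le> bessel_series'' x"
    unfolding e2(1) using assms decr[of _ 2]
    by (intro alternating_series_bounds[OF e2(2) assms(3)]; auto)
qed

text \<open>In the variable \<open>z\<close> with \<open>x = z\<^sup>2 / 4\<close> this quantity is \<open>J\<^sub>0\<^sup>2 + J\<^sub>0'\<^sup>2\<close>, the energy of a damped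
oscillator; in \<open>x\<close> its derivative is \<open>- (bessel_series' x)\<^sup>2\<close> by Bessel's equation. The value of the
energy at one point therefore bounds the modulus of the function everywhere to the right.\<close>

lemma bessel_series_energy_decreasing:
  assumes "x \<le> y"
  shows "(bessel_series y)\<^sup>2 + y * (bessel_series' y)\<^sup>2 \<le> (bessel_series x)\<^sup>2 + x * (bessel_series' x)\<^sup>2"
proof (rule DERIV_nonpos_imp_nonincreasing[OF assms])
  fix z
  note D = has_field_derivative_bessel_series[of z]
  have "((\<lambda>x. (bessel_series x)\<^sup>2 + x * (bessel_series' x)\<^sup>2) has_field_derivative
      2 * bessel_series z * bessel_series' z + ((bessel_series' z)\<^sup>2 + z * (2 * bessel_series' z * bessel_series'' z))) (at z)"
    by (auto intro!: derivative_eq_intros D simp: power2_eq_square)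
  also have "2 * bessel_series z * bessel_series' z + ((bessel_series' z)\<^sup>2 + z * (2 * bessel_series' z * bessel_series'' z))
    = 2 * bessel_series' z * (z * bessel_series'' z + bessel_series' z + bessel_series z) - (bessel_series' z)\<^sup>2"
    by (simp add: algebra_simps power2_eq_square)
  also have "\<dots> = - (bessel_series' z)\<^sup>2" by (simp add: bessel_series_ode)
  finally show "\<exists>D. ((\<lambda>x. (bessel_series x)\<^sup>2 + x * (bessel_series' x)\<^sup>2) has_real_derivative D) (at z) \<and> D \<le> 0"
    by (intro exI[of _ "- (bessel_series' z)\<^sup>2"]) auto
qed

text \<open>The number \<open>3.6704\<close> lies just to the left of the first minimum, which is at
\<open>x = 3.67049...\<close>. The derivative there is so small that its contribution to the energy is below
\<open>1 / 10 ^ 9\<close>; the sums of fourteen and fifteen terms are accurate enough for all four estimates.\<close>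

lemma bessel_series_at_minimum:
  shows "bessel_series 3.6704 \<ge> - 0.402759397" "bessel_series 3.6704 \<le> 0"
    "bessel_series' 3.6704 \<le> 0" "bessel_series' 3.6704 \<ge> - 0.000011"
proof -
  have r: "{..<14} = {0, 1, 2, 3, 4, 5, 6, 7, 8, 9, 10, 11, 12, 13::nat}"
    "{..<Suc 14} = {0, 1, 2, 3, 4, 5, 6, 7, 8, 9, 10, 11, 12, 13, 14::nat}" by (auto simp: numeral_eq_Suc less_Suc_eq)
  note B = bessel_series_bounds[of "3.6704" 14, unfolded r]
  show "bessel_series 3.6704 \<ge> - 0.402759397"
    by (rule order_trans[OF _ B(1)]) (simp_all add: fact_numeral power_divide)
  show "bessel_series 3.6704 \<le> 0"
    by (rule order_trans[OF B(2)]) (simp_all add: fact_numeral power_divide)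
  have "0 \<le> - bessel_series' 3.6704"
    by (rule order_trans[OF _ B(3)]) (simp_all add: fact_numeral power_divide)
  then show "bessel_series' 3.6704 \<le> 0" by simp
  have "- bessel_series' 3.6704 \<le> 0.000011"
    by (rule order_trans[OF B(4)]) (simp_all add: fact_numeral power_divide)
  then show "bessel_series' 3.6704 \<ge> - 0.000011" by simp
qed

text \<open>The global minimum of \<open>J\<^sub>0\<close> is its first local minimum. Up to \<open>3.6704\<close> the function decreases,
because it is convex there and its derivative is still nonpositive at the right end; beyond that point the
decreasing energy keeps its modulus below the required value.\<close>

lemma bessel_series_ge:
  assumes "x \<ge> 0" shows "bessel_series x \<ge> - 0.402759398"
proof (cases "x \<le> 3.6704")
  case True
  have "bessel_series' y \<le> bessel_series' 3.6704" if "0 \<le> y" "y \<le> 3.6704" for y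
  proof (rule DERIV_nonneg_imp_nondecreasing[OF that(2)])
    fix z assume z: "y \<le> z" "z \<le> 3.6704"
    \<comment> \<open>Completing the square, \<open>1/2 - z/6 + z\<^sup>2/48 = (z - 4)\<^sup>2/48 + 1/6\<close>, and \<open>z\<^sup>3/720\<close> stays below \<open>1/6\<close>.\<close>
    have "z ^ 3 \<le> 3.6704 ^ 3" using z that by (intro power_mono) auto
    moreover have "0 \<le> (z - 4)\<^sup>2" by simp
    ultimately have "0 \<le> 1/2 - z/6 + z\<^sup>2/48 - z^3/720"
      by (simp add: power2_eq_square power3_eq_cube field_simps)
    also have "\<dots> = (\<Sum>k<4. (-1) ^ k * (z ^ k / (fact k * fact (k + 2))))"
      by (simp add: numeral_eq_Suc field_simps)
    also have "\<dots> \<le> bessel_series'' z"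
      using bessel_series_bounds(5)[of z 4] z that by simp
    finally show "\<exists>D. (bessel_series' has_real_derivative D) (at z) \<and> 0 \<le> D"
      using has_field_derivative_bessel_series(2) by blast
  qed
  then have "bessel_series' y \<le> 0" if "x \<le> y" "y \<le> 3.6704" for y
    using that assms bessel_series_at_minimum(3) by (meson order_trans)
  then have "bessel_series 3.6704 \<le> bessel_series x"
    using True has_field_derivative_bessel_series(1) by (blast intro: DERIV_nonpos_imp_nonincreasing)
  with bessel_series_at_minimum(1) show ?thesis by simp
next
  case False
  have "(bessel_series x)\<^sup>2 \<le> (bessel_series x)\<^sup>2 + x * (bessel_series' x)\<^sup>2" using assms by simp
  also have "\<dots> \<le> (bessel_series 3.6704)\<^sup>2 + 3.6704 * (bessel_series' 3.6704)\<^sup>2"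
    using False by (intro bessel_series_energy_decreasing) auto
  also have "\<dots> \<le> 0.402759397\<^sup>2 + 3.6704 * 0.000011\<^sup>2"
    using bessel_series_at_minimum by (intro add_mono mult_left_mono abs_le_square_iff[THEN iffD1]) auto
  also have "\<dots> \<le> 0.402759398\<^sup>2" by (simp add: power2_eq_square)
  finally show ?thesis by (simp add: abs_le_square_iff[symmetric])
qed

lemma J0_ge: "J0 t \<ge> - 0.402759398"
  unfolding J0_eq_bessel_series by (rule bessel_series_ge) simp

section \<open>The Bessel function as an average of cosines over directions\<close>

text \<open>The uniform distribution on \<open>[0, 2\<pi>]\<close>, given by a density so that its \<open>\<sigma>\<close>-algebra is the Borel
algebra of the whole line.\<close>

definition angle_measure :: "real measure" where
  "angle_measure = density lborel (\<lambda>\<theta>. ennreal (indicator {0..2 * pi} \<theta> / (2 * pi)))"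

lemma sets_angle_measure [simp, measurable_cong]: "sets angle_measure = sets borel"
  by (simp add: angle_measure_def)

lemma space_angle_measure [simp]: "space angle_measure = UNIV"
  by (simp add: angle_measure_def)

lemma prob_space_angle_measure: "prob_space angle_measure"
proof
  have "emeasure angle_measure UNIV = (\<integral>\<^sup>+\<theta>. ennreal (1 / (2 * pi)) * indicator {0..2 * pi} \<theta> \<partial>lborel)"
    unfolding angle_measure_def
    by (subst emeasure_density) (auto intro!: nn_integral_cong simp: indicator_def)
  also have "\<dots> = ennreal (1 / (2 * pi)) * ennreal (2 * pi)"
    by (subst nn_integral_cmult_indicator) simp_all
  also have "\<dots> = 1" by (simp flip: ennreal_mult)
  finally show "emeasure angle_measure (space angle_measure) = 1" by simp
qed

interpretation angle: prob_space angle_measure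
  by (rule prob_space_angle_measure)

lemma integrable_angle_bounded:
  fixes f :: "real \<Rightarrow> real"
  assumes "f \<in> borel_measurable borel" "\<And>\<theta>. \<bar>f \<theta>\<bar> \<le> B"
  shows "integrable angle_measure f"
  using assms by (intro angle.integrable_const_bound[of _ B]) (auto simp: measurable_def)

lemma integral_angle_derivative_eq_0:
  fixes F f :: "real \<Rightarrow> real"
  assumes D: "\<And>\<theta>. (F has_real_derivative f \<theta>) (at \<theta>)" and cont: "continuous_on UNIV f"
    and per: "F (2 * pi) = F 0"
  shows "(\<integral>\<theta>. f \<theta> \<partial>angle_measure) = 0"
proof -
  have "(\<integral>\<theta>. f \<theta> * indicator {0..2 * pi} \<theta> \<partial>lborel) = F (2 * pi) - F 0"
    by (rule integral_FTC_Icc_real)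
       (use D cont in \<open>auto simp: has_real_derivative_iff_has_vector_derivative continuous_on_eq_continuous_at intro: has_vector_derivative_at_within\<close>)
  moreover have "(\<integral>\<theta>. f \<theta> \<partial>angle_measure)
      = (\<integral>\<theta>. (1 / (2 * pi)) * (f \<theta> * indicator {0..2 * pi} \<theta>) \<partial>lborel)"
    unfolding angle_measure_def using cont
    by (subst integral_density)
       (auto intro!: borel_measurable_continuous_onI Bochner_Integration.integral_cong simp: indicator_def)
  ultimately show ?thesis by (simp add: per)
qed

lemma abs_trig_le:
  fixes a b \<theta> :: real
  shows "\<bar>a * cos \<theta> + b * sin \<theta>\<bar> \<le> \<bar>a\<bar> + \<bar>b\<bar>"
proof -
  have "\<bar>a * cos \<theta>\<bar> \<le> \<bar>a\<bar> * 1" "\<bar>b * sin \<theta>\<bar> \<le> \<bar>b\<bar> * 1"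
    unfolding abs_mult by (intro mult_left_mono; simp)+
  then show ?thesis by linarith
qed

text \<open>With \<open>p = a cos \<theta> + b sin \<theta>\<close> and \<open>q = p'\<close> one has \<open>q' = - p\<close> and \<open>p\<^sup>2 + q\<^sup>2 = a\<^sup>2 + b\<^sup>2\<close>. Hence the
derivative of \<open>p\<^sup>2\<^sup>k\<^sup>+\<^sup>1 q\<close> is a combination of \<open>p\<^sup>2\<^sup>k\<close> and \<open>p\<^sup>2\<^sup>k\<^sup>+\<^sup>2\<close>, and it integrates to zero over a period,
which gives the recursion of Wallis.\<close>

lemma trig_moment:
  "(\<integral>\<theta>. (a * cos \<theta> + b * sin \<theta>) ^ (2 * k) \<partial>angle_measure)
     = fact (2 * k) / (4 ^ k * (fact k)\<^sup>2) * (a\<^sup>2 + b\<^sup>2) ^ k"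
proof (induction k)
  case 0
  show ?case using angle.prob_space by simp
next
  case (Suc k)
  let ?p = "\<lambda>\<theta>. a * cos \<theta> + b * sin \<theta>" and ?q = "\<lambda>\<theta>. b * cos \<theta> - a * sin \<theta>"
  let ?R = "a\<^sup>2 + b\<^sup>2"
  note pb = abs_trig_le[of a _ b]
  have int: "integrable angle_measure (\<lambda>\<theta>. ?p \<theta> ^ n)" for n
    using pb by (intro integrable_angle_bounded[where B = "(\<bar>a\<bar> + \<bar>b\<bar>) ^ n"])
      (auto simp: power_abs intro!: power_mono)
  have circle: "(?q \<theta>)\<^sup>2 = ?R - (?p \<theta>)\<^sup>2" for \<theta>
  proof -
    have "(?q \<theta>)\<^sup>2 + (?p \<theta>)\<^sup>2 = ?R * ((cos \<theta>)\<^sup>2 + (sin \<theta>)\<^sup>2)"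
      by algebra
    then show ?thesis by simp
  qed
  have "(\<integral>\<theta>. (2 * real k + 1) * ?R * ?p \<theta> ^ (2 * k) - (2 * real k + 2) * ?p \<theta> ^ (2 * Suc k) \<partial>angle_measure) = 0"
  proof (rule integral_angle_derivative_eq_0)
    fix \<theta>
    have "((\<lambda>\<theta>. ?p \<theta> ^ (2 * k + 1) * ?q \<theta>) has_real_derivative
        (2 * real k + 1) * ?p \<theta> ^ (2 * k) * (?q \<theta>)\<^sup>2 - ?p \<theta> ^ (2 * k + 2)) (at \<theta>)"
      by (rule derivative_eq_intros refl | simp)+ (simp add: power2_eq_square algebra_simps)
    then show "((\<lambda>\<theta>. ?p \<theta> ^ (2 * k + 1) * ?q \<theta>) has_real_derivative
        (2 * real k + 1) * ?R * ?p \<theta> ^ (2 * k) - (2 * real k + 2) * ?p \<theta> ^ (2 * Suc k)) (at \<theta>)"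
      unfolding circle by (simp add: algebra_simps power2_eq_square)
  qed (auto intro!: continuous_intros)
  then have "(2 * real k + 2) * (\<integral>\<theta>. ?p \<theta> ^ (2 * Suc k) \<partial>angle_measure)
      = (2 * real k + 1) * ?R * (\<integral>\<theta>. ?p \<theta> ^ (2 * k) \<partial>angle_measure)"
    unfolding Bochner_Integration.integral_diff[OF integrable_mult_right[OF int] integrable_mult_right[OF int]]
    by simp
  also have "\<dots> = (2 * real k + 1) * ?R * (fact (2 * k) / (4 ^ k * (fact k)\<^sup>2) * ?R ^ k)"
    unfolding Suc.IH ..
  also have "\<dots> = (2 * real k + 2) * (fact (2 * Suc k) / (4 ^ Suc k * (fact (Suc k))\<^sup>2) * ?R ^ Suc k)"
  proof -
    \<comment> \<open>The factors \<open>m = k + 1\<close> and \<open>n = 2k + 1\<close> that turn the constant for \<open>k\<close> into the one for \<open>k + 1\<close>.\<close>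
    have "n * (f / (e * g\<^sup>2)) = 2 * m * (2 * m * n * f / (4 * e * (m * g)\<^sup>2))"
      if "m \<noteq> 0" for n m f e g :: real
      using that by (simp add: power2_eq_square)
    from this[of "real k + 1" "2 * real k + 1" "fact (2 * k)" "4 ^ k" "fact k"]
    have key: "(2 * real k + 1) * (fact (2 * k) / (4 ^ k * (fact k)\<^sup>2))
        = (2 * real k + 2) * (2 * (real k + 1) * (2 * real k + 1) * fact (2 * k) / (4 * 4 ^ k * ((real k + 1) * fact k)\<^sup>2))"
      by simp
    have f: "fact (2 * Suc k) = 2 * (real k + 1) * (2 * real k + 1) * fact (2 * k)"
      "fact (Suc k) = (real k + 1) * fact k"
      by (simp_all add: algebra_simps)
    have "(2 * real k + 1) * ?R * (fact (2 * k) / (4 ^ k * (fact k)\<^sup>2) * ?R ^ k)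
        = ((2 * real k + 1) * (fact (2 * k) / (4 ^ k * (fact k)\<^sup>2))) * ?R ^ Suc k"
      by (simp only: power_Suc mult_ac)
    also have "\<dots> = (2 * real k + 2) * (fact (2 * Suc k) / (4 ^ Suc k * (fact (Suc k))\<^sup>2) * ?R ^ Suc k)"
      unfolding key f power_Suc[of 4] by (simp only: mult.assoc)
    finally show ?thesis .
  qed
  finally show ?case
    by (subst (asm) mult_left_cancel) (auto simp: add_eq_0_iff2 simp del: power_Suc mult_Suc_right)
qed

text \<open>Integrating the cosine series term by term turns the even moments into the coefficients of \<open>J0\<close>. When
\<open>a\<close> and \<open>b\<close> are the inner products of \<open>\<xi>\<close> with \<open>v\<close> and with \<open>v\<close> turned by a right angle, the integral is
the average of the plane wave of frequency \<open>\<xi>\<close> over all rotations of \<open>v\<close>.\<close>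

lemma J0_integral_representation:
  "(\<integral>\<theta>. cos (a * cos \<theta> + b * sin \<theta>) \<partial>angle_measure) = J0 (sqrt (a\<^sup>2 + b\<^sup>2))"
proof -
  let ?p = "\<lambda>\<theta>. a * cos \<theta> + b * sin \<theta>" and ?B = "\<bar>a\<bar> + \<bar>b\<bar>"
  let ?t = "\<lambda>k \<theta>. (-1) ^ k / fact (2 * k) * ?p \<theta> ^ (2 * k)"
  note pb = abs_trig_le[of a _ b]
  have tb: "\<bar>?t k \<theta>\<bar> \<le> ?B ^ (2 * k) / fact (2 * k)" for k \<theta>
    using power_mono[OF pb abs_ge_zero, of \<theta> "2 * k"]
    by (simp add: abs_mult power_abs divide_right_mono)
  have sm: "summable (\<lambda>k. ?B ^ (2 * k) / fact (2 * k))"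
  proof -
    have "summable (\<lambda>n. ?B ^ n / fact n)"
      using summable_exp[of ?B] by (simp add: field_simps)
    from summable_reindex[OF this, of "\<lambda>k. 2 * k"] show ?thesis
      by (simp add: comp_def inj_on_def)
  qed
  have "(\<integral>\<theta>. cos (?p \<theta>) \<partial>angle_measure) = (\<integral>\<theta>. (\<Sum>k. ?t k \<theta>) \<partial>angle_measure)"
    using cos_paired[THEN sums_unique] by simp
  also have "\<dots> = (\<Sum>k. \<integral>\<theta>. ?t k \<theta> \<partial>angle_measure)"
  proof (rule integral_suminf)
    show "integrable angle_measure (?t k)" for k
      using tb by (intro integrable_angle_bounded) auto
    show "AE \<theta> in angle_measure. summable (\<lambda>k. norm (?t k \<theta>))"
      using tb by (intro AE_I2 summable_comparison_test'[OF sm]) auto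
    show "summable (\<lambda>k. \<integral>\<theta>. norm (?t k \<theta>) \<partial>angle_measure)"
    proof (rule summable_comparison_test'[OF sm])
      fix k
      have "(\<integral>\<theta>. norm (?t k \<theta>) \<partial>angle_measure) \<le> (\<integral>\<theta>. ?B ^ (2 * k) / fact (2 * k) \<partial>angle_measure)"
        using tb by (intro integral_mono integrable_angle_bounded[where B = "?B ^ (2 * k) / fact (2 * k)"]) auto
      then show "norm (\<integral>\<theta>. norm (?t k \<theta>) \<partial>angle_measure) \<le> ?B ^ (2 * k) / fact (2 * k)"
        using angle.prob_space by simp
    qed
  qed
  also have "\<dots> = J0 (sqrt (a\<^sup>2 + b\<^sup>2))"
    unfolding J0_def
  proof (rule suminf_cong)
    fix k
    have "(sqrt (a\<^sup>2 + b\<^sup>2) / 2) ^ (2 * k) = (a\<^sup>2 + b\<^sup>2) ^ k / 4 ^ k"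
      by (simp add: power_mult power_divide)
    then show "(\<integral>\<theta>. ?t k \<theta> \<partial>angle_measure) = (-1) ^ k * (sqrt (a\<^sup>2 + b\<^sup>2) / 2) ^ (2 * k) / (fact k)\<^sup>2"
      by (simp add: trig_moment)
  qed
  finally show ?thesis .
qed

lemma abs_J0_le_1: "\<bar>J0 t\<bar> \<le> 1"
proof -
  have "\<bar>\<integral>\<theta>. cos (t * cos \<theta> + 0 * sin \<theta>) \<partial>angle_measure\<bar> \<le> (\<integral>\<theta>. 1 \<partial>angle_measure)"
    by (rule integral_abs_bound[THEN order_trans], rule integral_mono)
       (auto intro!: integrable_angle_bounded[where B = 1])
  moreover have "J0 t = J0 \<bar>t\<bar>" unfolding J0_def by (simp add: power_mult power_divide)
  ultimately show ?thesis
    unfolding J0_integral_representation using angle.prob_space by simp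
qed

section \<open>Gaussian measure and the Gaussian kernel\<close>

lemma prob_space_std_normal: "prob_space std_normal_distribution"
  using real_dist_normal_dist by (simp add: real_distribution_def)

interpretation std_normal_product: product_sigma_finite "\<lambda>_. std_normal_distribution"
  by (simp add: product_sigma_finite_def prob_space_std_normal prob_space_imp_sigma_finite)

text \<open>The standard normal distribution on a Euclidean space, as the law of a vector with independent standard
normal coordinates. Its Fourier transform is the unnormalized Gaussian kernel, which makes that kernel a
mixture of plane waves with positive weights.\<close>

definition gaussian :: "'a::euclidean_space measure" where
  "gaussian = distr (Pi\<^sub>M Basis (\<lambda>_. std_normal_distribution)) borel (\<lambda>f. \<Sum>b\<in>Basis. f b *\<^sub>R b)"

lemma sets_gaussian [simp, measurable_cong]: "sets gaussian = sets borel"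
  by (simp add: gaussian_def)

lemma space_gaussian [simp]: "space gaussian = UNIV"
  by (simp add: gaussian_def)

lemma coordinates_measurable:
  "(\<lambda>f. \<Sum>b\<in>Basis. f b *\<^sub>R b) \<in> Pi\<^sub>M Basis (\<lambda>_. std_normal_distribution) \<rightarrow>\<^sub>M (borel :: 'a::euclidean_space measure)"
  by measurable

interpretation gaussian: prob_space gaussian
  unfolding gaussian_def
  by (intro prob_space.prob_space_distr coordinates_measurable prob_space_PiM prob_space_std_normal)

lemma gaussian_fourier:
  fixes x :: "'a::euclidean_space"
  shows "(\<integral>\<xi>. cos (x \<bullet> \<xi>) \<partial>gaussian) = exp (- (norm x)\<^sup>2 / 2)"
proof -
  let ?P = "Pi\<^sub>M Basis (\<lambda>_::'a. std_normal_distribution)"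
  have meas: "(\<lambda>\<xi>. iexp (x \<bullet> \<xi>)) \<in> borel_measurable gaussian" by measurable
  have int: "integrable gaussian (\<lambda>\<xi>. iexp (x \<bullet> \<xi>))"
    using meas by (intro gaussian.integrable_const_bound[where B = 1]) auto
  have int1: "integrable std_normal_distribution (\<lambda>u. iexp (t * u))" for t
    by (intro finite_measure.integrable_const_bound[where B = 1]
        prob_space.finite_measure prob_space_std_normal) auto
  have "(\<integral>\<xi>. iexp (x \<bullet> \<xi>) \<partial>gaussian) = (\<integral>f. iexp (x \<bullet> (\<Sum>b\<in>Basis. f b *\<^sub>R b)) \<partial>?P)"
    unfolding gaussian_def by (rule integral_distr[OF coordinates_measurable]) auto
  also have "\<dots> = (\<integral>f. (\<Prod>b\<in>Basis. iexp ((x \<bullet> b) * f b)) \<partial>?P)"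
    by (intro Bochner_Integration.integral_cong refl)
       (simp add: inner_sum_right sum_distrib_left exp_sum mult_ac)
  also have "\<dots> = (\<Prod>b\<in>Basis. char std_normal_distribution (x \<bullet> b))"
    unfolding char_def by (intro std_normal_product.product_integral_prod int1) auto
  also have "\<dots> = of_real (exp (\<Sum>b\<in>Basis. - ((x \<bullet> b)\<^sup>2 / 2)))"
    by (simp add: char_std_normal_distribution exp_sum)
  also have "(\<Sum>b\<in>Basis. - ((x \<bullet> b)\<^sup>2 / 2)) = - (norm x)\<^sup>2 / 2"
    by (simp add: sum_negf norm_eq_sqrt_inner euclidean_inner[of x x] power2_eq_square sum_divide_distrib
        sum_nonneg)
  finally have "(\<integral>\<xi>. iexp (x \<bullet> \<xi>) \<partial>gaussian) = of_real (exp (- (norm x)\<^sup>2 / 2))" .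
  moreover have "(\<integral>\<xi>. cos (x \<bullet> \<xi>) \<partial>gaussian) = Re (\<integral>\<xi>. iexp (x \<bullet> \<xi>) \<partial>gaussian)"
    by (subst integral_Re[OF int, symmetric]) (simp add: Re_exp)
  ultimately show ?thesis by simp
qed

text \<open>The exponential of the norm is at most the product over the coordinates of \<open>exp (- d \<bar>x \<bullet> b\<bar>)\<close> with
\<open>d = c / DIM('a)\<close>, because each coordinate is bounded by the norm.\<close>

lemma integrable_exp_norm:
  fixes c :: real
  assumes c: "c > 0"
  shows "integrable lborel (\<lambda>x::'a::euclidean_space. exp (- c * norm x))"
proof -
  define d where "d = c / DIM('a)"
  have d: "d > 0" using c by (simp add: d_def)
  have one_dim: "integrable lborel (\<lambda>u::real. exp (- d * \<bar>u\<bar>))"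
  proof -
    have p: "integrable lborel (\<lambda>u. indicator {0<..} u * exp (- (u * d)))"
      using integrable_I0i_exp_mscale[OF d] by (simp add: set_integrable_def)
    have m: "integrable lborel (\<lambda>u. indicator {0<..} (- u) * exp (- (- u * d)))"
      using lborel_integrable_real_affine[OF p, of "-1" 0] by simp
    show ?thesis
      by (rule Bochner_Integration.integrable_cong_AE_imp[OF Bochner_Integration.integrable_add[OF p m]])
         (auto intro!: AE_I[of _ _ "{0}"] simp: indicator_def split: if_splits)
  qed
  have "integrable (Pi\<^sub>M Basis (\<lambda>_::'a. lborel)) (\<lambda>f. \<Prod>b\<in>Basis. exp (- d * \<bar>f b\<bar>))"
    using one_dim by (intro product_sigma_finite.product_integrable_prod)
      (auto simp: product_sigma_finite_def sigma_finite_lborel)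
  then have "integrable (Pi\<^sub>M Basis (\<lambda>_::'a. lborel))
      (\<lambda>f. \<Prod>b\<in>Basis. exp (- d * \<bar>(\<Sum>i\<in>Basis. f i *\<^sub>R i) \<bullet> b\<bar>))"
    by (simp add: inner_sum_left_Basis cong: prod.cong)
  then have int: "integrable lborel (\<lambda>x::'a. \<Prod>b\<in>Basis. exp (- d * \<bar>x \<bullet> b\<bar>))"
    by (subst lborel_eq, subst integrable_distr_eq) auto
  show ?thesis
  proof (rule Bochner_Integration.integrable_bound[OF int])
    show "AE x::'a in lborel. norm (exp (- c * norm x)) \<le> norm (\<Prod>b\<in>Basis. exp (- d * \<bar>x \<bullet> b\<bar>))"
    proof (rule AE_I2)
      fix x :: 'a
      have "(\<Sum>b\<in>Basis. d * \<bar>x \<bullet> b\<bar>) \<le> (\<Sum>b\<in>(Basis::'a set). d * norm x)"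
        using d by (intro sum_mono mult_left_mono Basis_le_norm) auto
      also have "\<dots> = c * norm x" by (simp add: d_def)
      finally have "exp (- c * norm x) \<le> exp (- (\<Sum>b\<in>Basis. d * \<bar>x \<bullet> b\<bar>))" by simp
      also have "\<dots> = (\<Prod>b\<in>Basis. exp (- d * \<bar>x \<bullet> b\<bar>))"
        by (simp add: exp_sum flip: sum_negf)
      finally show "norm (exp (- c * norm x)) \<le> norm (\<Prod>b\<in>Basis. exp (- d * \<bar>x \<bullet> b\<bar>))"
        by (simp add: prod_nonneg abs_prod)
    qed
  qed simp
qed

abbreviation (input) gauss_kernel :: "'a::euclidean_space \<Rightarrow> real" where
  "gauss_kernel z \<equiv> exp (- (norm z)\<^sup>2 / 2)"

lemma integrable_gauss_kernel: "integrable lborel (gauss_kernel :: 'a::euclidean_space \<Rightarrow> real)"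
proof (rule Bochner_Integration.integrable_bound)
  show "integrable lborel (\<lambda>x::'a. exp (1/2) * exp (- 1 * norm x))"
    by (intro integrable_mult_right integrable_exp_norm) auto
  show "AE x::'a in lborel. norm (gauss_kernel x) \<le> norm (exp (1/2) * exp (- 1 * norm x))"
  proof (rule AE_I2)
    fix x :: 'a
    have "0 \<le> (norm x - 1)\<^sup>2" by simp
    then have "- (norm x)\<^sup>2 / 2 \<le> 1/2 + (- 1 * norm x)" by (simp add: power2_eq_square algebra_simps)
    then have "gauss_kernel x \<le> exp (1/2 + (- 1 * norm x))" by simp
    then show "norm (gauss_kernel x) \<le> norm (exp (1/2) * exp (- 1 * norm x))" by (simp only: exp_add) simp
  qed
qed simp

lemma integral_positive:
  fixes f :: "'a::euclidean_space \<Rightarrow> real"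
  assumes "integrable lborel f" "\<And>x. f x > 0"
  shows "(\<integral>x. f x \<partial>lborel) > 0"
proof -
  have "(\<integral>x. f x \<partial>lborel) \<noteq> 0"
  proof
    assume "(\<integral>x. f x \<partial>lborel) = 0"
    then have "AE x in lborel. f x = 0"
      using integral_nonneg_eq_0_iff_AE[OF assms(1)] assms(2) by (simp add: less_imp_le)
    then have "AE x::'a in lborel. False" using assms(2) by (auto simp: less_imp_neq[symmetric])
    then show False
      by (simp add: eventually_False ae_filter_eq_bot_iff)
  qed
  moreover have "(\<integral>x. f x \<partial>lborel) \<ge> 0" using assms(2) by (intro Bochner_Integration.integral_nonneg) (simp add: less_imp_le)
  ultimately show ?thesis by linarith
qed

lemma integral_translate:
  fixes f :: "'a::euclidean_space \<Rightarrow> real"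
  assumes "f \<in> borel_measurable borel"
  shows "(\<integral>x. f (v + x) \<partial>lborel) = (\<integral>x. f x \<partial>lborel)"
  using integral_distr[of "(+) v" lborel borel f] assms by (simp add: lborel_distr_plus)

text \<open>The substitution \<open>y = p + z / s\<close>, which concentrates an integral over \<open>z\<close> at the point \<open>p\<close> as \<open>s\<close> grows.\<close>

lemma integral_rescale:
  fixes f :: "'a::euclidean_space \<Rightarrow> real"
  assumes "f \<in> borel_measurable borel" "s > 0"
  shows "s ^ DIM('a) * (\<integral>y. f y \<partial>lborel) = (\<integral>z. f (p + z /\<^sub>R s) \<partial>lborel)"
proof -
  have "(\<integral>y. f y \<partial>lborel) = (\<integral>y. f y \<partial>density (distr lborel borel (\<lambda>z. p + (1 / s) *\<^sub>R z)) (\<lambda>_. ennreal (\<bar>1 / s\<bar> ^ DIM('a))))"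
    using lborel_affine[of "1 / s" p] assms by (simp add: ennreal_power)
  also have "\<dots> = (\<integral>z. \<bar>1 / s\<bar> ^ DIM('a) * f (p + (1 / s) *\<^sub>R z) \<partial>lborel)"
    using assms by (subst integral_density) (auto simp: integral_distr)
  finally show ?thesis using assms by (simp add: power_one_over inverse_eq_divide)
qed

section \<open>Correlations and their spectral representation\<close>

text \<open>The form of Fubini's theorem needed for Fourier integrals: an integrable function against a bounded
kernel and a finite measure is integrable on the product.\<close>

lemma integral_bounded_kernel_swap:
  fixes p :: "'a \<Rightarrow> real" and q :: "'a \<Rightarrow> 'b \<Rightarrow> real"
  assumes "sigma_finite_measure M" "finite_measure N"
    and p: "integrable M p"
    and q [measurable]: "(\<lambda>(x, y). q x y) \<in> borel_measurable (M \<Otimes>\<^sub>M N)"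
    and bound: "\<And>x y. \<bar>q x y\<bar> \<le> B"
  shows "(\<integral>x. p x * (\<integral>y. q x y \<partial>N) \<partial>M) = (\<integral>y. (\<integral>x. p x * q x y \<partial>M) \<partial>N)"
proof -
  interpret M: sigma_finite_measure M by fact
  interpret N: finite_measure N by fact
  interpret pair_sigma_finite M N ..
  have [measurable]: "p \<in> borel_measurable M" using p by auto
  have qx: "integrable N (\<lambda>y. q x y)" if "x \<in> space M" for x
    using that bound by (intro N.integrable_const_bound[of _ B]) auto
  have "integrable (M \<Otimes>\<^sub>M N) (\<lambda>(x, y). p x * q x y)"
  proof (rule Fubini_integrable)
    show "integrable M (\<lambda>x. \<integral>y. norm (case (x, y) of (x, y) \<Rightarrow> p x * q x y) \<partial>N)"
    proof (rule Bochner_Integration.integrable_bound)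
      show "integrable M (\<lambda>x. (B * measure N (space N)) * p x)" using p by simp
      show "AE x in M. norm (\<integral>y. norm (case (x, y) of (x, y) \<Rightarrow> p x * q x y) \<partial>N)
          \<le> norm (B * measure N (space N) * p x)"
      proof (rule AE_I2)
        fix x assume x: "x \<in> space M"
        have B: "0 \<le> B" using bound[of x undefined] by linarith
        have "(\<integral>y. \<bar>q x y\<bar> \<partial>N) \<le> (\<integral>y. B \<partial>N)"
          using bound qx[OF x] by (intro integral_mono) auto
        then have "\<bar>p x\<bar> * (\<integral>y. \<bar>q x y\<bar> \<partial>N) \<le> \<bar>p x\<bar> * (B * measure N (space N))"
          by (intro mult_left_mono) (auto simp: mult.commute)
        then show "norm (\<integral>y. norm (case (x, y) of (x, y) \<Rightarrow> p x * q x y) \<partial>N)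
          \<le> norm (B * measure N (space N) * p x)"
          using B by (simp add: abs_mult mult_ac)
      qed
    qed measurable
  qed (use qx in \<open>auto intro!: AE_I2\<close>)
  from Fubini_integral[OF this] show ?thesis by simp
qed

lemma integrable_mult_bounded:
  fixes g q :: "'a::euclidean_space \<Rightarrow> real"
  assumes g: "integrable lborel g" and q: "q \<in> borel_measurable borel" and b: "\<And>x. \<bar>q x\<bar> \<le> B"
  shows "integrable lborel (\<lambda>x. g x * q x)"
proof (rule Bochner_Integration.integrable_bound)
  show "integrable lborel (\<lambda>x. B * g x)" using g by simp
  show "(\<lambda>x. g x * q x) \<in> borel_measurable lborel" using g q by auto
  show "AE x in lborel. norm (g x * q x) \<le> norm (B * g x)"
  proof (rule AE_I2)
    fix x
    have "\<bar>q x\<bar> \<le> \<bar>B\<bar>" using b[of x] by linarith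
    then have "\<bar>g x\<bar> * \<bar>q x\<bar> \<le> \<bar>g x\<bar> * \<bar>B\<bar>" by (intro mult_left_mono) auto
    then show "norm (g x * q x) \<le> norm (B * g x)" by (simp add: abs_mult mult_ac)
  qed
qed

definition correlation :: "('a::euclidean_space \<Rightarrow> real) \<Rightarrow> 'a \<Rightarrow> real" where
  "correlation g v = (\<integral>x. g x * g (x + v) \<partial>lborel)"

text \<open>The correlation at \<open>v\<close> blurred by a Gaussian of width \<open>1 / s\<close>. The blurring makes the Fourier
representation an absolutely convergent integral; the factor
\<open>s ^ DIM('a)\<close> keeps the total mass of the kernel constant in \<open>s\<close>.\<close>

definition smoothed_correlation :: "('a::euclidean_space \<Rightarrow> real) \<Rightarrow> real \<Rightarrow> 'a \<Rightarrow> real" where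
  "smoothed_correlation g s v
     = s ^ DIM('a) * (\<integral>x. g x * (\<integral>y. g y * gauss_kernel (s *\<^sub>R (y - (x + v))) \<partial>lborel) \<partial>lborel)"

definition power_spectrum :: "('a::euclidean_space \<Rightarrow> real) \<Rightarrow> 'a \<Rightarrow> real" where
  "power_spectrum g \<xi> = (\<integral>x. g x * cos (x \<bullet> \<xi>) \<partial>lborel)\<^sup>2 + (\<integral>x. g x * sin (x \<bullet> \<xi>) \<partial>lborel)\<^sup>2"

lemma abs_integral_mult_le:
  fixes g q :: "'a::euclidean_space \<Rightarrow> real"
  assumes g: "integrable lborel g" and q: "q \<in> borel_measurable borel" and b: "\<And>x. \<bar>q x\<bar> \<le> B"
  shows "\<bar>\<integral>x. g x * q x \<partial>lborel\<bar> \<le> B * (\<integral>x. \<bar>g x\<bar> \<partial>lborel)"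
proof -
  have "\<bar>\<integral>x. g x * q x \<partial>lborel\<bar> \<le> (\<integral>x. \<bar>g x * q x\<bar> \<partial>lborel)" by (rule integral_abs_bound)
  also have "\<dots> \<le> (\<integral>x. B * \<bar>g x\<bar> \<partial>lborel)"
  proof (rule integral_mono)
    show "integrable lborel (\<lambda>x. \<bar>g x * q x\<bar>)"
      using integrable_mult_bounded[OF assms] by simp
    show "integrable lborel (\<lambda>x. B * \<bar>g x\<bar>)" using g by simp
    show "\<bar>g x * q x\<bar> \<le> B * \<bar>g x\<bar>" for x
      using mult_left_mono[OF b[of x] abs_ge_zero[of "g x"]] by (simp add: abs_mult mult_ac)
  qed
  finally show ?thesis by simp
qed

context
  fixes g :: "'a::euclidean_space \<Rightarrow> real"
  assumes g: "integrable lborel g"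
begin

lemma g_measurable: "g \<in> borel_measurable borel"
  using g by auto

lemma measurable_power_spectrum: "power_spectrum g \<in> borel_measurable borel"
proof -
  note [measurable] = g_measurable
  show ?thesis unfolding power_spectrum_def[abs_def] by measurable
qed

lemma power_spectrum_nonneg: "0 \<le> power_spectrum g \<xi>"
  by (simp add: power_spectrum_def)

lemma power_spectrum_bounded: "power_spectrum g \<xi> \<le> 2 * (\<integral>x. \<bar>g x\<bar> \<partial>lborel)\<^sup>2"
proof -
  have "\<bar>\<integral>x. g x * cos (x \<bullet> \<xi>) \<partial>lborel\<bar> \<le> 1 * (\<integral>x. \<bar>g x\<bar> \<partial>lborel)"
    "\<bar>\<integral>x. g x * sin (x \<bullet> \<xi>) \<partial>lborel\<bar> \<le> 1 * (\<integral>x. \<bar>g x\<bar> \<partial>lborel)"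
    by (rule abs_integral_mult_le[OF g]; simp)+
  then have "(\<integral>x. g x * cos (x \<bullet> \<xi>) \<partial>lborel)\<^sup>2 \<le> (\<integral>x. \<bar>g x\<bar> \<partial>lborel)\<^sup>2"
    "(\<integral>x. g x * sin (x \<bullet> \<xi>) \<partial>lborel)\<^sup>2 \<le> (\<integral>x. \<bar>g x\<bar> \<partial>lborel)\<^sup>2"
    by (auto simp: abs_le_square_iff[symmetric])
  then show ?thesis by (simp add: power_spectrum_def)
qed

text \<open>Write the Gaussian kernel as a superposition of the waves \<open>cos (s (y - x - v) \<bullet> \<xi>)\<close> and integrate over
\<open>y\<close> and then over \<open>x\<close>. By the addition theorems the result depends on \<open>g\<close> only through the squared modulus
of its Fourier transform; the sine terms cancel.\<close>

lemma smoothed_correlation_spectral: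
  "smoothed_correlation g s v
     = s ^ DIM('a) * (\<integral>\<xi>. power_spectrum g (s *\<^sub>R \<xi>) * cos (s * (v \<bullet> \<xi>)) \<partial>gaussian)"
proof -
  define C where "C \<xi> = (\<integral>x. g x * cos (s * (x \<bullet> \<xi>)) \<partial>lborel)" for \<xi>
  define S where "S \<xi> = (\<integral>x. g x * sin (s * (x \<bullet> \<xi>)) \<partial>lborel)" for \<xi>
  define G where "G = (\<integral>x. \<bar>g x\<bar> \<partial>lborel)"
  note [measurable] = g_measurable
  have [measurable]: "C \<in> borel_measurable borel" "S \<in> borel_measurable borel"
    unfolding C_def[abs_def] S_def[abs_def] by measurable
  have CG: "\<bar>C \<xi>\<bar> \<le> G" and SG: "\<bar>S \<xi>\<bar> \<le> G" for \<xi>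
    unfolding C_def S_def G_def
    using abs_integral_mult_le[OF g, of "\<lambda>x. cos (s * (x \<bullet> \<xi>))" 1]
      abs_integral_mult_le[OF g, of "\<lambda>x. sin (s * (x \<bullet> \<xi>))" 1] by simp_all
  have int: "integrable lborel (\<lambda>x. g x * cos (s * (x \<bullet> \<xi>)))"
    "integrable lborel (\<lambda>x. g x * sin (s * (x \<bullet> \<xi>)))" for \<xi>
    by (rule integrable_mult_bounded[OF g, where B = 1]; simp)+
  have cos_part: "(\<integral>x. g x * cos (s * (x \<bullet> \<xi>) + c) \<partial>lborel) = C \<xi> * cos c - S \<xi> * sin c" for \<xi> c
  proof -
    have "(\<integral>x. g x * cos (s * (x \<bullet> \<xi>) + c) \<partial>lborel)
        = (\<integral>x. g x * cos (s * (x \<bullet> \<xi>)) * cos c - g x * sin (s * (x \<bullet> \<xi>)) * sin c \<partial>lborel)"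
      by (simp add: cos_add algebra_simps)
    then show ?thesis using int[of \<xi>] by (simp add: C_def S_def)
  qed
  have sin_part: "(\<integral>x. g x * sin (s * (x \<bullet> \<xi>) + c) \<partial>lborel) = S \<xi> * cos c + C \<xi> * sin c" for \<xi> c
  proof -
    have "(\<integral>x. g x * sin (s * (x \<bullet> \<xi>) + c) \<partial>lborel)
        = (\<integral>x. g x * sin (s * (x \<bullet> \<xi>)) * cos c + g x * cos (s * (x \<bullet> \<xi>)) * sin c \<partial>lborel)"
      by (simp add: sin_add algebra_simps)
    then show ?thesis using int[of \<xi>] by (simp add: C_def S_def)
  qed
  have inner: "(\<integral>y. g y * gauss_kernel (s *\<^sub>R (y - z)) \<partial>lborel)
      = (\<integral>\<xi>. C \<xi> * cos (s * (z \<bullet> \<xi>)) + S \<xi> * sin (s * (z \<bullet> \<xi>)) \<partial>gaussian)" for z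
  proof -
    have "(\<integral>y. g y * gauss_kernel (s *\<^sub>R (y - z)) \<partial>lborel)
        = (\<integral>y. g y * (\<integral>\<xi>. cos (s * (y \<bullet> \<xi>) + - (s * (z \<bullet> \<xi>))) \<partial>gaussian) \<partial>lborel)"
      unfolding gaussian_fourier[symmetric] by (simp add: inner_diff_left algebra_simps)
    also have "\<dots> = (\<integral>\<xi>. (\<integral>y. g y * cos (s * (y \<bullet> \<xi>) + - (s * (z \<bullet> \<xi>))) \<partial>lborel) \<partial>gaussian)"
      by (rule integral_bounded_kernel_swap[OF sigma_finite_lborel gaussian.finite_measure_axioms g, of _ 1])
         auto
    finally show ?thesis unfolding cos_part by simp
  qed
  let ?q = "\<lambda>x \<xi>. C \<xi> * cos (s * ((x + v) \<bullet> \<xi>)) + S \<xi> * sin (s * ((x + v) \<bullet> \<xi>))"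
  have "\<bar>a * c + b * d\<bar> \<le> G + G" if "\<bar>a\<bar> \<le> G" "\<bar>b\<bar> \<le> G" "\<bar>c\<bar> \<le> 1" "\<bar>d\<bar> \<le> 1" for a b c d
  proof -
    have "0 \<le> G" using that by linarith
    then have "\<bar>a\<bar> * \<bar>c\<bar> \<le> G * 1" "\<bar>b\<bar> * \<bar>d\<bar> \<le> G * 1" using that by (intro mult_mono; simp)+
    then show ?thesis by (simp flip: abs_mult)
  qed
  then have qb: "\<bar>?q x \<xi>\<bar> \<le> G + G" for x \<xi>
    using CG SG by simp
  have "(\<integral>x. g x * (\<integral>\<xi>. ?q x \<xi> \<partial>gaussian) \<partial>lborel) = (\<integral>\<xi>. (\<integral>x. g x * ?q x \<xi> \<partial>lborel) \<partial>gaussian)"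
    using qb by (intro integral_bounded_kernel_swap[OF sigma_finite_lborel gaussian.finite_measure_axioms g, of _ "G + G"])
      auto
  also have "\<dots> = (\<integral>\<xi>. power_spectrum g (s *\<^sub>R \<xi>) * cos (s * (v \<bullet> \<xi>)) \<partial>gaussian)"
  proof (rule Bochner_Integration.integral_cong[OF refl])
    fix \<xi>
    let ?c = "s * (v \<bullet> \<xi>)"
    have i: "integrable lborel (\<lambda>x. g x * cos (s * (x \<bullet> \<xi>) + ?c))"
      "integrable lborel (\<lambda>x. g x * sin (s * (x \<bullet> \<xi>) + ?c))"
      by (rule integrable_mult_bounded[OF g, where B = 1]; simp)+
    have "(\<integral>x. g x * ?q x \<xi> \<partial>lborel)
       = (\<integral>x. C \<xi> * (g x * cos (s * (x \<bullet> \<xi>) + ?c)) + S \<xi> * (g x * sin (s * (x \<bullet> \<xi>) + ?c)) \<partial>lborel)"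
      by (simp add: inner_add_left algebra_simps)
    also have "\<dots> = C \<xi> * (C \<xi> * cos ?c - S \<xi> * sin ?c) + S \<xi> * (S \<xi> * cos ?c + C \<xi> * sin ?c)"
      using i by (simp add: cos_part sin_part)
    also have "\<dots> = ((C \<xi>)\<^sup>2 + (S \<xi>)\<^sup>2) * cos ?c"
      by (simp add: algebra_simps power2_eq_square)
    finally show "(\<integral>x. g x * ?q x \<xi> \<partial>lborel) = power_spectrum g (s *\<^sub>R \<xi>) * cos ?c"
      by (simp add: power_spectrum_def C_def S_def)
  qed
  finally show ?thesis unfolding smoothed_correlation_def inner by simp
qed

lemma smoothed_correlation_rescaled:
  assumes "s > 0"
  shows "smoothed_correlation g s v
    = (\<integral>x. g x * (\<integral>z. g (x + v + z /\<^sub>R s) * gauss_kernel z \<partial>lborel) \<partial>lborel)"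
proof -
  note [measurable] = g_measurable
  have "s ^ DIM('a) * (\<integral>y. g y * gauss_kernel (s *\<^sub>R (y - p)) \<partial>lborel)
      = (\<integral>z. g (p + z /\<^sub>R s) * gauss_kernel z \<partial>lborel)" for p
    using assms by (subst integral_rescale[where p = p]) auto
  then show ?thesis
    unfolding smoothed_correlation_def
    by (subst integral_mult_right_zero[symmetric]) (simp add: mult.left_commute[of "s ^ DIM('a)"])
qed

context
  fixes B :: real
  assumes cont: "continuous_on UNIV g" and bound: "\<And>x. \<bar>g x\<bar> \<le> B"
begin

lemma gauss_average_bounded:
  "\<bar>\<integral>z. g (p + z /\<^sub>R s) * gauss_kernel z \<partial>lborel\<bar> \<le> B * (\<integral>z. gauss_kernel (z::'a) \<partial>lborel)"
proof -
  note [measurable] = g_measurable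
  have "\<bar>\<integral>z. gauss_kernel z * g (p + z /\<^sub>R s) \<partial>lborel\<bar> \<le> B * (\<integral>z. \<bar>gauss_kernel (z::'a)\<bar> \<partial>lborel)"
    by (rule abs_integral_mult_le[OF integrable_gauss_kernel _ bound]) measurable
  then show ?thesis by (simp add: mult.commute)
qed

lemma smoothed_correlation_bounded:
  assumes "s > 0"
  shows "\<bar>smoothed_correlation g s v\<bar> \<le> B * (\<integral>z. gauss_kernel (z::'a) \<partial>lborel) * (\<integral>x. \<bar>g x\<bar> \<partial>lborel)"
proof -
  note [measurable] = g_measurable
  show ?thesis
    unfolding smoothed_correlation_rescaled[OF assms]
    by (rule abs_integral_mult_le[OF g _ gauss_average_bounded]) measurable
qed

text \<open>The Gaussian averages of the continuous bounded function \<open>g\<close> converge pointwise, so two applications of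
dominated convergence remove the blurring. The kernel is not normalized, whence the constant factor.\<close>

lemma smoothed_correlation_tendsto:
  "(\<lambda>n. smoothed_correlation g (real (Suc n)) v)
     \<longlonglongrightarrow> (\<integral>z. gauss_kernel (z::'a) \<partial>lborel) * correlation g v"
proof -
  note [measurable] = g_measurable
  have avg: "(\<lambda>n. \<integral>z. g (p + z /\<^sub>R real (Suc n)) * gauss_kernel z \<partial>lborel)
      \<longlonglongrightarrow> (\<integral>z. g p * gauss_kernel (z::'a) \<partial>lborel)" for p
  proof (rule integral_dominated_convergence[where w = "\<lambda>z::'a. B * gauss_kernel z"])
    show "AE z in lborel. (\<lambda>n. g (p + z /\<^sub>R real (Suc n)) * gauss_kernel z) \<longlonglongrightarrow> g p * gauss_kernel z"
    proof (intro AE_I2 tendsto_mult tendsto_const)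
      fix z :: 'a
      have "(\<lambda>n. p + inverse (real (Suc n)) *\<^sub>R z) \<longlonglongrightarrow> p + 0 *\<^sub>R z"
        by (intro tendsto_intros LIMSEQ_inverse_real_of_nat)
      then show "(\<lambda>n. g (p + z /\<^sub>R real (Suc n))) \<longlonglongrightarrow> g p"
        using cont continuous_on_tendsto_compose[of UNIV g _ p] by simp
    qed
    show "integrable lborel (\<lambda>z::'a. B * gauss_kernel z)"
      by (intro integrable_mult_right integrable_gauss_kernel)
  qed (use bound in \<open>auto intro!: mult_right_mono simp: abs_mult\<close>)
  have "(\<lambda>n. \<integral>x. g x * (\<integral>z. g (x + v + z /\<^sub>R real (Suc n)) * gauss_kernel z \<partial>lborel) \<partial>lborel)
      \<longlonglongrightarrow> (\<integral>x. g x * (\<integral>z. g (x + v) * gauss_kernel (z::'a) \<partial>lborel) \<partial>lborel)"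
  proof (rule integral_dominated_convergence[where w = "\<lambda>x. \<bar>g x\<bar> * (B * (\<integral>z. gauss_kernel (z::'a) \<partial>lborel))"])
    show "AE x in lborel. norm (g x * (\<integral>z. g (x + v + z /\<^sub>R real (Suc n)) * gauss_kernel z \<partial>lborel))
      \<le> \<bar>g x\<bar> * (B * (\<integral>z. gauss_kernel (z::'a) \<partial>lborel))" for n
      unfolding real_norm_def abs_mult by (intro AE_I2 mult_left_mono gauss_average_bounded) auto
  qed (use g avg in \<open>auto intro!: AE_I2 tendsto_mult tendsto_const simp del: of_nat_Suc\<close>)
  moreover have "(\<integral>x. g x * (\<integral>z. g (x + v) * gauss_kernel (z::'a) \<partial>lborel) \<partial>lborel)
      = correlation g v * (\<integral>z. gauss_kernel (z::'a) \<partial>lborel)"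
    by (simp add: correlation_def flip: mult.assoc)
  ultimately show ?thesis
    by (simp add: smoothed_correlation_rescaled mult.commute[of "correlation g v"] del: of_nat_Suc)
qed

end

end

section \<open>Rotation averages of correlations in the plane\<close>

text \<open>The vector turned by a right angle; it supplies the sine part of a rotation.\<close>

definition perp :: "real^2 \<Rightarrow> real^2" where
  "perp v = vector [- v $ 2, v $ 1]"

definition rotation :: "real \<Rightarrow> real^2 \<Rightarrow> real^2" where
  "rotation \<theta> v = cos \<theta> *\<^sub>R v + sin \<theta> *\<^sub>R perp v"

lemma perp_inner_identity: "(v \<bullet> \<xi>)\<^sup>2 + (perp v \<bullet> \<xi>)\<^sup>2 = (norm v)\<^sup>2 * (norm \<xi>)\<^sup>2"
  unfolding power2_norm_eq_inner
  by (simp add: perp_def inner_vec_def sum_2 power2_eq_square algebra_simps)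

lemma norm_rotation [simp]: "norm (rotation \<theta> v) = norm v"
proof -
  have "(norm (rotation \<theta> v))\<^sup>2 = (cos \<theta>)\<^sup>2 * (norm v)\<^sup>2 + (sin \<theta>)\<^sup>2 * (norm v)\<^sup>2"
    unfolding power2_norm_eq_inner rotation_def
    by (simp add: perp_def inner_vec_def sum_2 power2_eq_square algebra_simps)
  also have "\<dots> = (norm v)\<^sup>2" by (simp flip: distrib_right)
  finally show ?thesis by simp
qed

lemma rotation_diff: "rotation \<theta> (v - w) = rotation \<theta> v - rotation \<theta> w"
  by (simp add: rotation_def perp_def vec_eq_iff forall_2 algebra_simps)

lemma rotation_zero [simp]: "rotation \<theta> 0 = 0"
  using rotation_diff[of \<theta> 0 0] by simp

lemma rotation_scaleR: "rotation \<theta> (k *\<^sub>R v) = k *\<^sub>R rotation \<theta> v"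
  by (simp add: rotation_def perp_def vec_eq_iff forall_2 algebra_simps)

lemma measurable_rotation [measurable]: "(\<lambda>\<theta>. rotation \<theta> v) \<in> borel_measurable borel"
  unfolding rotation_def by measurable

lemma rotation_average_cos:
  assumes "s \<ge> 0"
  shows "(\<integral>\<theta>. cos (s * (rotation \<theta> v \<bullet> \<xi>)) \<partial>angle_measure) = J0 (norm v * (s * norm \<xi>))"
proof -
  have "s * (rotation \<theta> v \<bullet> \<xi>) = (s * (v \<bullet> \<xi>)) * cos \<theta> + (s * (perp v \<bullet> \<xi>)) * sin \<theta>" for \<theta>
    by (simp add: rotation_def inner_add_left algebra_simps)
  moreover have "(s * (v \<bullet> \<xi>))\<^sup>2 + (s * (perp v \<bullet> \<xi>))\<^sup>2 = (norm v * (s * norm \<xi>))\<^sup>2"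
    using perp_inner_identity[of v \<xi>] by (simp add: power_mult_distrib flip: distrib_left)
  ultimately show ?thesis
    using assms by (simp add: J0_integral_representation)
qed

lemma rotation_average_smoothed_correlation:
  fixes g :: "real^2 \<Rightarrow> real"
  assumes g: "integrable lborel g" and s: "s \<ge> 0"
  shows "(\<integral>\<theta>. smoothed_correlation g s (rotation \<theta> v) \<partial>angle_measure)
    = s\<^sup>2 * (\<integral>\<xi>. power_spectrum g (s *\<^sub>R \<xi>) * J0 (norm v * (s * norm \<xi>)) \<partial>gaussian)"
proof -
  note [measurable] = measurable_power_spectrum[OF g]
  have int: "integrable gaussian (\<lambda>\<xi>. power_spectrum g (s *\<^sub>R \<xi>))"
    using power_spectrum_bounded[OF g] power_spectrum_nonneg[OF g]
    by (intro gaussian.integrable_const_bound[where B = "2 * (\<integral>x. \<bar>g x\<bar> \<partial>lborel)\<^sup>2"]) auto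
  have "(\<integral>\<xi>. power_spectrum g (s *\<^sub>R \<xi>) * (\<integral>\<theta>. cos (s * (rotation \<theta> v \<bullet> \<xi>)) \<partial>angle_measure) \<partial>gaussian)
      = (\<integral>\<theta>. (\<integral>\<xi>. power_spectrum g (s *\<^sub>R \<xi>) * cos (s * (rotation \<theta> v \<bullet> \<xi>)) \<partial>gaussian) \<partial>angle_measure)"
    by (rule integral_bounded_kernel_swap[OF gaussian.sigma_finite_measure_axioms
          angle.finite_measure_axioms int, of _ 1]) auto
  then show ?thesis
    by (simp add: smoothed_correlation_spectral[OF g] rotation_average_cos[OF s])
qed

lemma measurable_correlation_rotation:
  fixes g :: "real^2 \<Rightarrow> real"
  assumes [measurable]: "g \<in> borel_measurable borel"
  shows "(\<lambda>\<theta>. correlation g (rotation \<theta> v)) \<in> borel_measurable borel"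
  unfolding correlation_def by measurable

lemma measurable_smoothed_correlation_rotation:
  fixes g :: "real^2 \<Rightarrow> real"
  assumes [measurable]: "g \<in> borel_measurable borel"
  shows "(\<lambda>\<theta>. smoothed_correlation g s (rotation \<theta> v)) \<in> borel_measurable borel"
  unfolding smoothed_correlation_def by measurable

text \<open>For the blurred correlation, averaging over rotations replaces \<open>cos (s (v \<bullet> \<xi>))\<close> in the spectral
representation by \<open>J0\<close>. The power spectrum is nonnegative, so a pointwise lower bound for the sum of Bessel
functions passes to the integral and gives \<open>m\<close> times the blurred correlation at \<open>0\<close>. Letting the
blurring vanish gives the claim.\<close>

lemma rotation_average_correlation_ge_continuous:
  fixes g :: "real^2 \<Rightarrow> real" and v :: "'i \<Rightarrow> real^2"
  assumes g: "integrable lborel g" and cont: "continuous_on UNIV g" and bound: "\<And>x. \<bar>g x\<bar> \<le> B"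
    and J: "\<And>t. t \<ge> 0 \<Longrightarrow> m \<le> (\<Sum>i\<in>I. J0 (norm (v i) * t))"
  shows "m * correlation g 0 \<le> (\<Sum>i\<in>I. \<integral>\<theta>. correlation g (rotation \<theta> (v i)) \<partial>angle_measure)"
proof -
  define K where "K = (\<integral>z. gauss_kernel (z::real^2) \<partial>lborel)"
  define T where "T n u = smoothed_correlation g (real (Suc n)) u" for n u
  have K: "K > 0" unfolding K_def by (intro integral_positive integrable_gauss_kernel) auto
  have T: "(\<lambda>n. T n u) \<longlonglongrightarrow> K * correlation g u" for u
    unfolding T_def K_def by (rule smoothed_correlation_tendsto[OF g cont bound])
  note [measurable] = measurable_power_spectrum[OF g]
  have gm: "g \<in> borel_measurable borel" using g by auto
  have [measurable]: "(\<lambda>\<theta>. correlation g (rotation \<theta> u)) \<in> borel_measurable borel"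
    "(\<lambda>\<theta>. T n (rotation \<theta> u)) \<in> borel_measurable borel" for u n
    unfolding T_def by (intro measurable_correlation_rotation measurable_smoothed_correlation_rotation gm)+
  have ineq: "m * T n 0 \<le> (\<Sum>i\<in>I. \<integral>\<theta>. T n (rotation \<theta> (v i)) \<partial>angle_measure)" for n
  proof -
    let ?s = "real (Suc n)"
    let ?P = "\<lambda>\<xi>. power_spectrum g (?s *\<^sub>R \<xi>)"
    let ?C = "2 * (\<integral>x. \<bar>g x\<bar> \<partial>lborel)\<^sup>2"
    have P: "integrable gaussian ?P"
      using power_spectrum_bounded[OF g] power_spectrum_nonneg[OF g]
      by (intro gaussian.integrable_const_bound[where B = ?C]) auto
    have J0m [measurable]: "J0 \<in> borel_measurable borel"
      unfolding J0_def[abs_def] by measurable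
    have PJ: "integrable gaussian (\<lambda>\<xi>. ?P \<xi> * J0 (norm (v i) * (?s * norm \<xi>)))" for i
    proof (rule Bochner_Integration.integrable_bound[OF P])
      show "AE \<xi> in gaussian. norm (?P \<xi> * J0 (norm (v i) * (?s * norm \<xi>))) \<le> norm (?P \<xi>)"
        using abs_J0_le_1 by (intro AE_I2) (simp add: abs_mult mult_left_le)
    qed measurable
    have "m * (\<integral>\<xi>. ?P \<xi> \<partial>gaussian) = (\<integral>\<xi>. ?P \<xi> * m \<partial>gaussian)" by simp
    also have "\<dots> \<le> (\<integral>\<xi>. (\<Sum>i\<in>I. ?P \<xi> * J0 (norm (v i) * (?s * norm \<xi>))) \<partial>gaussian)"
    proof (rule integral_mono)
      show "?P \<xi> * m \<le> (\<Sum>i\<in>I. ?P \<xi> * J0 (norm (v i) * (?s * norm \<xi>)))" for \<xi>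
        unfolding sum_distrib_left[symmetric]
        by (intro mult_left_mono J power_spectrum_nonneg[OF g]) auto
    qed (use P PJ in auto)
    also have "\<dots> = (\<Sum>i\<in>I. \<integral>\<xi>. ?P \<xi> * J0 (norm (v i) * (?s * norm \<xi>)) \<partial>gaussian)"
      using PJ by (rule Bochner_Integration.integral_sum)
    finally have "?s\<^sup>2 * (m * (\<integral>\<xi>. ?P \<xi> \<partial>gaussian))
        \<le> ?s\<^sup>2 * (\<Sum>i\<in>I. \<integral>\<xi>. ?P \<xi> * J0 (norm (v i) * (?s * norm \<xi>)) \<partial>gaussian)"
      by (intro mult_left_mono) auto
    then show ?thesis
      unfolding T_def smoothed_correlation_spectral[OF g, of ?s 0]
      by (simp add: rotation_average_smoothed_correlation[OF g] sum_distrib_left mult.left_commute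
          del: of_nat_Suc)
  qed
  have "(\<lambda>n. \<integral>\<theta>. T n (rotation \<theta> (v i)) \<partial>angle_measure)
      \<longlonglongrightarrow> (\<integral>\<theta>. K * correlation g (rotation \<theta> (v i)) \<partial>angle_measure)" for i
  proof (rule integral_dominated_convergence[where w = "\<lambda>_. B * K * (\<integral>x. \<bar>g x\<bar> \<partial>lborel)"])
    show "AE \<theta> in angle_measure. norm (T n (rotation \<theta> (v i))) \<le> B * K * (\<integral>x. \<bar>g x\<bar> \<partial>lborel)" for n
      unfolding T_def K_def real_norm_def
      by (intro AE_I2 smoothed_correlation_bounded[OF g cont bound]) simp
    show "(\<lambda>\<theta>. K * correlation g (rotation \<theta> (v i))) \<in> borel_measurable angle_measure" by measurable
    show "(\<lambda>\<theta>. T n (rotation \<theta> (v i))) \<in> borel_measurable angle_measure" for n by measurable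
  qed (use T in auto)
  then have "(\<lambda>n. \<Sum>i\<in>I. \<integral>\<theta>. T n (rotation \<theta> (v i)) \<partial>angle_measure)
      \<longlonglongrightarrow> (\<Sum>i\<in>I. \<integral>\<theta>. K * correlation g (rotation \<theta> (v i)) \<partial>angle_measure)"
    by (intro tendsto_sum)
  from LIMSEQ_le[OF tendsto_mult[OF tendsto_const T] this] ineq
  have "m * (K * correlation g 0) \<le> (\<Sum>i\<in>I. \<integral>\<theta>. K * correlation g (rotation \<theta> (v i)) \<partial>angle_measure)"
    by blast
  also have "\<dots> = K * (\<Sum>i\<in>I. \<integral>\<theta>. correlation g (rotation \<theta> (v i)) \<partial>angle_measure)"
    by (simp add: sum_distrib_left)
  finally have "K * (m * correlation g 0)
      \<le> K * (\<Sum>i\<in>I. \<integral>\<theta>. correlation g (rotation \<theta> (v i)) \<partial>angle_measure)"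
    by (simp add: mult_ac)
  then show ?thesis using K by simp
qed

lemma integrable_mult_translate:
  fixes g :: "'a::euclidean_space \<Rightarrow> real"
  assumes g: "integrable lborel g" and h: "h \<in> borel_measurable borel" "\<And>x. \<bar>h x\<bar> \<le> B"
  shows "integrable lborel (\<lambda>x. g x * h (x + v))"
  using h by (intro integrable_mult_bounded[OF g, where B = B]) auto

lemma integrable_translate:
  fixes f :: "'a::euclidean_space \<Rightarrow> real"
  assumes "integrable lborel f"
  shows "integrable lborel (\<lambda>x. f (x + v))"
  using integrable_distr[of "(+) v" lborel borel f] assms
  by (simp add: lborel_distr_plus add.commute)

lemma correlation_perturbation:
  fixes g h :: "'a::euclidean_space \<Rightarrow> real"
  assumes g: "integrable lborel g" "\<And>x. \<bar>g x\<bar> \<le> 1" and h: "integrable lborel h" "\<And>x. \<bar>h x\<bar> \<le> 1"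
  shows "\<bar>correlation g v - correlation h v\<bar> \<le> 2 * (\<integral>x. \<bar>g x - h x\<bar> \<partial>lborel)"
proof -
  have [measurable]: "g \<in> borel_measurable borel" "h \<in> borel_measurable borel" using g h by auto
  let ?d = "\<lambda>x. \<bar>g x - h x\<bar>"
  have d: "integrable lborel ?d" using g h by simp
  have ig: "integrable lborel (\<lambda>x. g x * g (x + v))" and ih: "integrable lborel (\<lambda>x. h x * h (x + v))"
    using g h by (auto intro!: integrable_mult_translate[where B = 1])
  have "\<bar>correlation g v - correlation h v\<bar> = \<bar>\<integral>x. g x * g (x + v) - h x * h (x + v) \<partial>lborel\<bar>"
    unfolding correlation_def using ig ih by simp
  also have "\<dots> \<le> (\<integral>x. \<bar>g x * g (x + v) - h x * h (x + v)\<bar> \<partial>lborel)"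
    by (rule integral_abs_bound)
  also have "\<dots> \<le> (\<integral>x. ?d x + ?d (x + v) \<partial>lborel)"
  proof (rule integral_mono)
    fix x
    have "g x * g (x + v) - h x * h (x + v) = (g x - h x) * g (x + v) + h x * (g (x + v) - h (x + v))"
      by (simp add: algebra_simps)
    then have "\<bar>g x * g (x + v) - h x * h (x + v)\<bar> \<le> ?d x * \<bar>g (x + v)\<bar> + \<bar>h x\<bar> * ?d (x + v)"
      using abs_triangle_ineq by (metis abs_mult)
    also have "\<dots> \<le> ?d x * 1 + 1 * ?d (x + v)"
      using g h by (intro add_mono mult_left_mono mult_right_mono) auto
    finally show "\<bar>g x * g (x + v) - h x * h (x + v)\<bar> \<le> ?d x + ?d (x + v)" by simp
  qed (use ig ih d integrable_translate[OF d] in auto)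
  also have "\<dots> = (\<integral>x. ?d x \<partial>lborel) + (\<integral>x. ?d (x + v) \<partial>lborel)"
    using d integrable_translate[OF d, of v] by (rule Bochner_Integration.integral_add)
  also have "(\<integral>x. ?d (x + v) \<partial>lborel) = (\<integral>x. ?d x \<partial>lborel)"
    using integral_translate[of ?d v] by (simp add: add.commute)
  finally show ?thesis by simp
qed

text \<open>Every Lebesgue measurable function is an almost everywhere limit of continuous functions. Truncating
these between \<open>- w\<close> and \<open>w\<close> changes nothing in the limit and provides the dominating function.\<close>

lemma continuous_L1_approximation:
  fixes g w :: "'a::euclidean_space \<Rightarrow> real"
  assumes g: "g \<in> borel_measurable borel" and w: "continuous_on UNIV w" "integrable lborel w"
    and gw: "\<And>x. \<bar>g x\<bar> \<le> w x"
  shows "\<exists>h. (\<forall>n. continuous_on UNIV (h n)) \<and> (\<forall>n x. \<bar>h n x\<bar> \<le> w x) \<and>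
    (\<lambda>n. \<integral>x. \<bar>g x - h n x\<bar> \<partial>lborel) \<longlonglongrightarrow> 0"
proof -
  have "g measurable_on UNIV"
    using g by (intro lebesgue_measurable_imp_measurable_on) (auto simp: measurable_completion)
  then obtain N k where N: "negligible N" and k: "\<And>n. continuous_on UNIV (k n)"
    and lim: "\<And>x. x \<notin> N \<Longrightarrow> (\<lambda>n. k n x) \<longlonglongrightarrow> g x"
    unfolding measurable_on_def by auto
  define h where "h n x = max (- w x) (min (w x) (k n x))" for n x
  have h_cont: "continuous_on UNIV (h n)" for n
    unfolding h_def by (intro continuous_intros k w)
  have w0: "0 \<le> w x" for x using gw[of x] by linarith
  have hw: "\<bar>h n x\<bar> \<le> w x" for n x
    using w0[of x] by (auto simp: h_def)
  have [measurable]: "h n \<in> borel_measurable borel" for n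
    using h_cont by (rule borel_measurable_continuous_onI)
  note [measurable] = g
  have "(\<lambda>n. \<integral>x. \<bar>g x - h n x\<bar> \<partial>lebesgue) \<longlonglongrightarrow> (\<integral>x. 0 \<partial>(lebesgue :: 'a measure))"
  proof (rule integral_dominated_convergence[where w = "\<lambda>x. 2 * w x"])
    show "integrable lebesgue (\<lambda>x. 2 * w x)"
      using w(2) by (intro integrable_mult_right) (simp add: integrable_completion)
    have "AE x in lebesgue. x \<notin> N"
      using N by (simp add: negligible_iff_null_sets AE_not_in)
    then show "AE x in lebesgue. (\<lambda>n. \<bar>g x - h n x\<bar>) \<longlonglongrightarrow> 0"
    proof eventually_elim
      case (elim x)
      have "(\<lambda>n. h n x) \<longlonglongrightarrow> max (- w x) (min (w x) (g x))"
        unfolding h_def by (intro tendsto_intros lim elim)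
      then have "(\<lambda>n. h n x) \<longlonglongrightarrow> g x" using gw[of x] by (simp add: min_def max_def split: if_splits)
      from tendsto_rabs[OF tendsto_diff[OF tendsto_const[of "g x"] this]] show ?case by simp
    qed
    show "AE x in lebesgue. norm \<bar>g x - h n x\<bar> \<le> 2 * w x" for n
    proof (rule AE_I2)
      fix x show "norm \<bar>g x - h n x\<bar> \<le> 2 * w x" using gw[of x] hw[of n x] by (simp add: abs_le_iff)
    qed
    show "(\<lambda>x. \<bar>g x - h n x\<bar>) \<in> borel_measurable lebesgue" for n
      by (intro measurable_completion) measurable
  qed simp
  then have "(\<lambda>n. \<integral>x. \<bar>g x - h n x\<bar> \<partial>lborel) \<longlonglongrightarrow> 0"
    by (subst (asm) integral_completion) auto
  with h_cont hw show ?thesis by blast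
qed

text \<open>The same inequality without continuity of \<open>g\<close>: correlations depend continuously on \<open>g\<close> in \<open>L\<^sup>1\<close> among
functions bounded by \<open>1\<close>, uniformly in the displacement.\<close>

lemma rotation_average_correlation_ge:
  fixes g :: "real^2 \<Rightarrow> real" and v :: "'i \<Rightarrow> real^2"
  assumes g: "g \<in> borel_measurable borel" and w: "continuous_on UNIV w" "integrable lborel w"
    and gw: "\<And>x. \<bar>g x\<bar> \<le> w x" and w1: "\<And>x. w x \<le> 1"
    and J: "\<And>t. t \<ge> 0 \<Longrightarrow> m \<le> (\<Sum>i\<in>I. J0 (norm (v i) * t))"
  shows "m * correlation g 0 \<le> (\<Sum>i\<in>I. \<integral>\<theta>. correlation g (rotation \<theta> (v i)) \<partial>angle_measure)"
proof -
  have int: "integrable lborel k" if "k \<in> borel_measurable borel" "\<And>x. \<bar>k x\<bar> \<le> w x" for k :: "real^2 \<Rightarrow> real"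
    using that by (intro Bochner_Integration.integrable_bound[OF w(2)] AE_I2) (auto intro: order_trans[OF _ abs_ge_self])
  have le1: "\<bar>k x\<bar> \<le> 1" if "\<And>x. \<bar>k x\<bar> \<le> w x" for k :: "real^2 \<Rightarrow> real" and x
    using that[of x] w1[of x] by linarith
  obtain h where h: "\<And>n. continuous_on UNIV (h n)" "\<And>n x. \<bar>h n x\<bar> \<le> w x"
    and lim: "(\<lambda>n. \<integral>x. \<bar>g x - h n x\<bar> \<partial>lborel) \<longlonglongrightarrow> 0"
    using continuous_L1_approximation[OF g w gw] by blast
  let ?e = "\<lambda>n. 2 * (\<integral>x. \<bar>g x - h n x\<bar> \<partial>lborel)"
  have hm: "h n \<in> borel_measurable borel" for n
    using h(1) by (rule borel_measurable_continuous_onI)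
  have pert: "\<bar>correlation g u - correlation (h n) u\<bar> \<le> ?e n" for n u
    using int[OF g gw] le1[OF gw] int[OF hm h(2)] le1[OF h(2)] by (rule correlation_perturbation)
  have e: "?e \<longlonglongrightarrow> 0" using tendsto_mult_right_zero[OF lim] by simp
  have corr_lim: "(\<lambda>n. correlation (h n) u) \<longlonglongrightarrow> correlation g u" for u
    by (rule LIM_zero_cancel, rule Lim_null_comparison[OF _ e], rule always_eventually)
       (use pert in \<open>simp add: abs_minus_commute\<close>)
  have int_corr: "integrable angle_measure (\<lambda>\<theta>. correlation k (rotation \<theta> u))"
    if "k \<in> borel_measurable borel" "\<And>x. \<bar>k x\<bar> \<le> w x" for k u
  proof (rule integrable_angle_bounded)
    show "\<bar>correlation k (rotation \<theta> u)\<bar> \<le> 1 * (\<integral>x. \<bar>k x\<bar> \<partial>lborel)" for \<theta>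
      unfolding correlation_def using that le1[OF that(2)]
      by (intro abs_integral_mult_le int) auto
  qed (rule measurable_correlation_rotation[OF that(1)])
  have "(\<lambda>n. \<integral>\<theta>. correlation (h n) (rotation \<theta> u) \<partial>angle_measure)
      \<longlonglongrightarrow> (\<integral>\<theta>. correlation g (rotation \<theta> u) \<partial>angle_measure)" for u
  proof (rule LIM_zero_cancel, rule Lim_null_comparison[OF _ e], rule always_eventually, rule allI)
    fix n
    have "norm ((\<integral>\<theta>. correlation (h n) (rotation \<theta> u) \<partial>angle_measure) - (\<integral>\<theta>. correlation g (rotation \<theta> u) \<partial>angle_measure))
      = \<bar>\<integral>\<theta>. correlation (h n) (rotation \<theta> u) - correlation g (rotation \<theta> u) \<partial>angle_measure\<bar>"
      using int_corr[OF hm h(2)] int_corr[OF g gw] by simp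
    also have "\<dots> \<le> (\<integral>\<theta>. \<bar>correlation (h n) (rotation \<theta> u) - correlation g (rotation \<theta> u)\<bar> \<partial>angle_measure)"
      by (rule integral_abs_bound)
    also have "\<dots> \<le> (\<integral>\<theta>. ?e n \<partial>angle_measure)"
      using int_corr[OF hm h(2)] int_corr[OF g gw] pert
      by (intro integral_mono) (auto simp: abs_minus_commute)
    finally show "norm ((\<integral>\<theta>. correlation (h n) (rotation \<theta> u) \<partial>angle_measure) - (\<integral>\<theta>. correlation g (rotation \<theta> u) \<partial>angle_measure)) \<le> ?e n"
      using angle.prob_space by simp
  qed
  then have "(\<lambda>n. \<Sum>i\<in>I. \<integral>\<theta>. correlation (h n) (rotation \<theta> (v i)) \<partial>angle_measure)
      \<longlonglongrightarrow> (\<Sum>i\<in>I. \<integral>\<theta>. correlation g (rotation \<theta> (v i)) \<partial>angle_measure)"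
    by (intro tendsto_sum)
  moreover have "(\<lambda>n. m * correlation (h n) 0) \<longlonglongrightarrow> m * correlation g 0"
    by (intro tendsto_intros corr_lim)
  moreover have "m * correlation (h n) 0 \<le> (\<Sum>i\<in>I. \<integral>\<theta>. correlation (h n) (rotation \<theta> (v i)) \<partial>angle_measure)" for n
    by (rule rotation_average_correlation_ge_continuous[OF int[OF hm h(2)] h(1) le1[OF h(2)] J])
  ultimately show ?thesis by (blast intro: LIMSEQ_le)
qed

section \<open>Colorings\<close>

text \<open>A Borel function with values \<open>1\<close> and \<open>- 1\<close> is needed for integrals over products, while the colors are
only Lebesgue measurable; the two differ on a null set.\<close>

lemma measurable_coloring_sign_function:
  assumes "measurable_coloring C1 C2"
  obtains f N where "f \<in> borel_measurable borel" "\<And>x. f x = 1 \<or> f x = (-1::real)"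
    "N \<in> null_sets lborel" "\<And>x. x \<notin> N \<Longrightarrow> f x = (if x \<in> C1 then 1 else -1)"
proof -
  have "C1 \<in> sets (completion lborel)" using assms by (simp add: measurable_coloring_def)
  then obtain S M N where C1: "C1 = S \<union> M" "M \<subseteq> N" "N \<in> null_sets lborel" "S \<in> sets lborel"
    by (rule sets_completionE)
  let ?f = "\<lambda>x. 2 * indicator S x - (1::real)"
  have "?f \<in> borel_measurable borel" using C1(4) by auto
  moreover have "?f x = 1 \<or> ?f x = -1" for x by (auto simp: indicator_def)
  moreover have "?f x = (if x \<in> C1 then 1 else -1)" if "x \<notin> N" for x
    using C1(1,2) that by (auto simp: indicator_def)
  ultimately show ?thesis using that C1(3) by blast
qed

lemma AE_translate_not_in_null:
  fixes N :: "'a::euclidean_space set"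
  assumes N: "N \<in> null_sets lborel"
  shows "AE x in lborel. x + u \<notin> N"
proof -
  have Nb: "N \<in> sets borel" using N by auto
  have "emeasure lborel ((+) u -` N \<inter> space lborel) = emeasure (distr lborel borel ((+) u)) N"
    using Nb by (subst emeasure_distr) auto
  also have "\<dots> = 0" using N by (simp add: lborel_distr_plus null_sets_def)
  finally have "(+) u -` N \<in> null_sets lborel"
    using Nb measurable_sets[of "(+) u" borel borel N] by (simp add: null_sets_def)
  from AE_not_in[OF this] show ?thesis by (simp add: add.commute)
qed

lemma no_monochromatic_products:
  fixes a b c :: real
  assumes "a \<in> {1, -1}" "b \<in> {1, -1}" "c \<in> {1, -1}" "\<not> (a = b \<and> b = c)"
  shows "a * b + a * c + b * c = -1"
  using assms by auto

text \<open>The weight \<open>exp (- \<delta> \<bar>x\<bar>)\<close> changes only by a factor close to \<open>1\<close> under bounded translations when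
\<open>\<delta>\<close> is small. It thus plays the role of the indicator function of a large disk, whose boundary is
negligible against its area.\<close>

lemma exp_weight_translate:
  fixes x u u' :: "'a::real_normed_vector"
  assumes d: "\<delta> \<ge> 0" and r: "norm u \<le> r" "norm u' \<le> r" and e: "exp (2 * \<delta> * r) \<le> 1 + \<epsilon>"
  shows "\<bar>exp (- \<delta> * norm (x + u)) * exp (- \<delta> * norm (x + u')) - (exp (- \<delta> * norm x))\<^sup>2\<bar>
    \<le> \<epsilon> * (exp (- \<delta> * norm x))\<^sup>2"
proof -
  define y where "y = \<delta> * (2 * norm x - norm (x + u) - norm (x + u'))"
  have n: "\<bar>norm x - norm (x + w)\<bar> \<le> norm w" for w
    using norm_triangle_ineq3[of x "x + w"] by simp
  have "\<bar>2 * norm x - norm (x + u) - norm (x + u')\<bar> \<le> 2 * r"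
    using n[of u] n[of u'] r by linarith
  then have "\<bar>y\<bar> \<le> \<delta> * (2 * r)"
    unfolding y_def abs_mult using d by (intro mult_mono) auto
  then have "exp \<bar>y\<bar> \<le> exp (2 * \<delta> * r)" by (simp add: mult_ac)
  with e have y: "exp \<bar>y\<bar> \<le> 1 + \<epsilon>" by linarith
  have "\<bar>exp y - 1\<bar> \<le> exp \<bar>y\<bar> - 1"
  proof (cases "y \<ge> 0")
    case False
    have "exp y < 1" using False by simp
    then show ?thesis using exp_ge_add_one_self[of "-y"] exp_ge_add_one_self[of y] False by linarith
  qed simp
  with y have "\<bar>exp y - 1\<bar> \<le> \<epsilon>" by linarith
  moreover have "exp (- \<delta> * norm (x + u)) * exp (- \<delta> * norm (x + u')) - (exp (- \<delta> * norm x))\<^sup>2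
      = (exp y - 1) * (exp (- \<delta> * norm x))\<^sup>2"
    by (simp add: y_def power2_eq_square left_diff_distrib algebra_simps flip: exp_add)
  ultimately show ?thesis by (simp add: abs_mult mult_right_mono)
qed

lemma correlation_diff:
  fixes g :: "'a::euclidean_space \<Rightarrow> real"
  assumes [measurable]: "g \<in> borel_measurable borel"
  shows "correlation g (u' - u) = (\<integral>x. g (x + u) * g (x + u') \<partial>lborel)"
proof -
  have "correlation g (u' - u) = (\<integral>x. g (u + x) * g (u + x + (u' - u)) \<partial>lborel)"
    unfolding correlation_def by (rule integral_translate[symmetric]) measurable
  also have "\<dots> = (\<integral>x. g (x + u) * g (x + u') \<partial>lborel)" by (simp add: add.commute)
  finally show ?thesis .
qed

text \<open>Let \<open>f = \<plusminus>1\<close> record the colors. If no congruent copy \<open>p, p + b', p + c'\<close> is monochromatic, then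
\<open>f(p) f(p + b') + f(p) f(p + c') + f(p + b') f(p + c') = - 1\<close> for all \<open>p\<close> and all rotations. Integrating
against a slowly varying weight, the correlations of \<open>g = f w\<close> at \<open>b'\<close>, \<open>c'\<close> and \<open>c' - b'\<close> have a sum close to
\<open>- W\<close>, where \<open>W\<close> is the correlation of \<open>g\<close> at \<open>0\<close>. The average of that sum over all rotations is at least
\<open>m W\<close>, and \<open>m > - 1\<close>. This is a contradiction once the error, three times \<open>\<epsilon> W\<close>, is below \<open>(1 + m) W\<close>.\<close>

lemma monochromatic_rotated_copy:
  fixes b c :: "real^2"
  assumes J: "\<And>t. t \<ge> 0 \<Longrightarrow> m \<le> J0 (norm b * t) + J0 (norm c * t) + J0 (norm (c - b) * t)"
    and m: "m > -1" and col: "measurable_coloring C1 C2"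
  obtains p \<theta> where "monochromatic C1 C2 {p, p + rotation \<theta> b, p + rotation \<theta> c}"
proof (rule ccontr)
  assume "\<not> thesis"
  then have no: "\<not> monochromatic C1 C2 {p, p + rotation \<theta> b, p + rotation \<theta> c}" for p \<theta>
    using that by blast
  obtain f N where f [measurable]: "f \<in> borel_measurable borel" and f1: "\<And>x. f x = 1 \<or> f x = (-1::real)"
    and N: "N \<in> null_sets lborel" and fN: "\<And>x. x \<notin> N \<Longrightarrow> f x = (if x \<in> C1 then 1 else -1)"
    using measurable_coloring_sign_function[OF col] by metis
  have C2: "x \<in> C2 \<longleftrightarrow> x \<notin> C1" for x using col by (auto simp: measurable_coloring_def)
  define \<epsilon> where "\<epsilon> = (1 + m) / 6"
  define r where "r = norm b + norm c + 1"
  \<comment> \<open>Chosen so that \<open>exp (2 \<delta> r) = 1 + \<epsilon>\<close>, where \<open>r\<close> bounds all displacements that occur.\<close>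
  define \<delta> where "\<delta> = ln (1 + \<epsilon>) / (2 * r)"
  have \<epsilon>: "\<epsilon> > 0" using m by (simp add: \<epsilon>_def)
  have r: "r > 0" by (simp add: r_def add_nonneg_pos)
  have \<delta>: "\<delta> > 0" using \<epsilon> r by (simp add: \<delta>_def)
  have e: "exp (2 * \<delta> * r) \<le> 1 + \<epsilon>" using \<epsilon> r by (simp add: \<delta>_def)
  define w where "w x = exp (- \<delta> * norm x)" for x :: "real^2"
  define g where "g x = f x * w x" for x
  have w_cont: "continuous_on UNIV w" unfolding w_def by (intro continuous_intros)
  have w_int: "integrable lborel w" unfolding w_def[abs_def] by (rule integrable_exp_norm[OF \<delta>])
  have w_pos: "w x > 0" and w_le: "w x \<le> 1" for x using \<delta> by (auto simp: w_def)
  have [measurable]: "w \<in> borel_measurable borel" using w_cont by (rule borel_measurable_continuous_onI)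
  have gm [measurable]: "g \<in> borel_measurable borel" unfolding g_def[abs_def] by measurable
  have f_abs: "\<bar>f x\<bar> = 1" and f_sq: "f x * f x = 1" for x using f1[of x] by auto
  have gw: "\<bar>g x\<bar> \<le> w x" for x
    using w_pos[of x] by (simp add: g_def abs_mult f_abs)
  have g_le: "\<bar>g x\<bar> \<le> 1" for x using gw w_le order_trans by blast
  have g_int: "integrable lborel g"
    using gw by (intro Bochner_Integration.integrable_bound[OF w_int] AE_I2) (auto intro: order_trans[OF _ abs_ge_self])
  define W where "W = (\<integral>x. (w x)\<^sup>2 \<partial>lborel)"
  have w2: "integrable lborel (\<lambda>x. (w x)\<^sup>2)"
    using integrable_mult_bounded[OF w_int, of w 1] w_le w_pos
    by (simp add: power2_eq_square less_imp_le)
  have W: "W > 0" unfolding W_def by (intro integral_positive w2 zero_less_power w_pos)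
  have "g x * g (x + 0) = (w x)\<^sup>2" for x
    using f_sq[of x] by (simp add: g_def) algebra
  then have W_eq: "correlation g 0 = W" unfolding correlation_def W_def by simp
  have f_int: "integrable lborel (\<lambda>x. f (x + u) * f (x + u') * (w x)\<^sup>2)" for u u'
    using integrable_mult_bounded[OF w2, of "\<lambda>x. f (x + u) * f (x + u')" 1]
    by (simp add: abs_mult f_abs mult.commute)
  \<comment> \<open>Replacing the two translated weights by \<open>(w x)\<^sup>2\<close> costs at most \<open>\<epsilon> W\<close>.\<close>
  have pair: "correlation g (u' - u) \<le> (\<integral>x. f (x + u) * f (x + u') * (w x)\<^sup>2 \<partial>lborel) + \<epsilon> * W"
    if "norm u \<le> r" "norm u' \<le> r" for u u'
  proof -
    have "integrable lborel (\<lambda>x. g x * g (x + (u' - u)))"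
      by (rule integrable_mult_translate[OF g_int gm g_le])
    then have "integrable lborel (\<lambda>x. g (x + u) * g (x + u + (u' - u)))"
      by (rule integrable_translate)
    moreover have "x + u + (u' - u) = x + u'" for x by simp
    ultimately have i1: "integrable lborel (\<lambda>x. g (x + u) * g (x + u'))" by simp
    have "correlation g (u' - u) = (\<integral>x. g (x + u) * g (x + u') \<partial>lborel)"
      by (rule correlation_diff[OF gm])
    also have "\<dots> \<le> (\<integral>x. f (x + u) * f (x + u') * (w x)\<^sup>2 + \<epsilon> * (w x)\<^sup>2 \<partial>lborel)"
    proof (rule integral_mono[OF i1])
      fix x
      have "g (x + u) * g (x + u') - f (x + u) * f (x + u') * (w x)\<^sup>2
          = f (x + u) * f (x + u') * (w (x + u) * w (x + u') - (w x)\<^sup>2)"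
        by (simp add: g_def algebra_simps)
      also have "\<dots> \<le> \<bar>w (x + u) * w (x + u') - (w x)\<^sup>2\<bar>"
        by (rule order_trans[OF abs_ge_self]) (simp add: abs_mult f_abs)
      also have "\<dots> \<le> \<epsilon> * (w x)\<^sup>2"
        unfolding w_def using \<delta> that e by (intro exp_weight_translate[where r = r]) auto
      finally show "g (x + u) * g (x + u') \<le> f (x + u) * f (x + u') * (w x)\<^sup>2 + \<epsilon> * (w x)\<^sup>2" by simp
    qed (use f_int w2 in simp)
    also have "\<dots> = (\<integral>x. f (x + u) * f (x + u') * (w x)\<^sup>2 \<partial>lborel) + \<epsilon> * W"
      using f_int w2 by (simp add: W_def)
    finally show ?thesis .
  qed
  have upper: "correlation g (rotation \<theta> b) + correlation g (rotation \<theta> c) + correlation g (rotation \<theta> (c - b))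
      \<le> - W + 3 * (\<epsilon> * W)" for \<theta>
  proof -
    let ?b = "rotation \<theta> b" and ?c = "rotation \<theta> c"
    have nr: "norm ?b \<le> r" "norm ?c \<le> r" "norm (0::real^2) \<le> r" by (auto simp: r_def)
    have "(\<integral>x. f (x + 0) * f (x + ?b) * (w x)\<^sup>2 \<partial>lborel) + (\<integral>x. f (x + 0) * f (x + ?c) * (w x)\<^sup>2 \<partial>lborel)
        + (\<integral>x. f (x + ?b) * f (x + ?c) * (w x)\<^sup>2 \<partial>lborel)
      = (\<integral>x. f (x + 0) * f (x + ?b) * (w x)\<^sup>2 + f (x + 0) * f (x + ?c) * (w x)\<^sup>2
          + f (x + ?b) * f (x + ?c) * (w x)\<^sup>2 \<partial>lborel)"
      using f_int by (simp only: Bochner_Integration.integral_add Bochner_Integration.integrable_add)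
    also have "\<dots> = (\<integral>x. - (w x)\<^sup>2 \<partial>lborel)"
    proof (rule integral_cong_AE)
      show "AE x in lborel. f (x + 0) * f (x + ?b) * (w x)\<^sup>2 + f (x + 0) * f (x + ?c) * (w x)\<^sup>2
          + f (x + ?b) * f (x + ?c) * (w x)\<^sup>2 = - (w x)\<^sup>2"
        using AE_translate_not_in_null[OF N, of 0] AE_translate_not_in_null[OF N, of ?b]
          AE_translate_not_in_null[OF N, of ?c]
      proof eventually_elim
        case (elim x)
        have "f y = 1 \<longleftrightarrow> y \<in> C1" if "y \<notin> N" for y using fN[OF that] by simp
        then have "f x = 1 \<longleftrightarrow> x \<in> C1" "f (x + ?b) = 1 \<longleftrightarrow> x + ?b \<in> C1" "f (x + ?c) = 1 \<longleftrightarrow> x + ?c \<in> C1"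
          using elim by simp_all
        moreover have "\<not> (x \<in> C1 \<and> x + ?b \<in> C1 \<and> x + ?c \<in> C1)"
          "\<not> (x \<notin> C1 \<and> x + ?b \<notin> C1 \<and> x + ?c \<notin> C1)"
          using no[of x \<theta>] by (simp_all add: monochromatic_def C2)
        ultimately have "\<not> (f x = f (x + ?b) \<and> f (x + ?b) = f (x + ?c))" by metis
        then have "f x * f (x + ?b) + f x * f (x + ?c) + f (x + ?b) * f (x + ?c) = -1"
          using f1 by (intro no_monochromatic_products) auto
        then have "(f x * f (x + ?b) + f x * f (x + ?c) + f (x + ?b) * f (x + ?c)) * (w x)\<^sup>2 = - (w x)\<^sup>2"
          by simp
        then show ?case by (simp only: distrib_right add_0_right)
      qed
    qed measurable
    also have "\<dots> = - W" by (simp add: W_def)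
    finally show ?thesis
      using pair[OF nr(3,1)] pair[OF nr(3,2)] pair[OF nr(1,2)] by (simp add: rotation_diff)
  qed
  let ?v = "\<lambda>i::nat. [b, c, c - b] ! i"
  have I: "{..<3} = {0, 1, 2::nat}" by auto
  have g_corr: "integrable angle_measure (\<lambda>\<theta>. correlation g (rotation \<theta> u))" for u
  proof (rule integrable_angle_bounded)
    show "\<bar>correlation g (rotation \<theta> u)\<bar> \<le> 1 * (\<integral>x. \<bar>g x\<bar> \<partial>lborel)" for \<theta>
      unfolding correlation_def using g_le
      by (intro abs_integral_mult_le g_int) auto
  qed (rule measurable_correlation_rotation[OF gm])
  have "m * correlation g 0 \<le> (\<Sum>i<3. \<integral>\<theta>. correlation g (rotation \<theta> (?v i)) \<partial>angle_measure)"
    by (rule rotation_average_correlation_ge[OF gm w_cont w_int gw w_le]) (use J in \<open>simp add: I add.assoc\<close>)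
  also have "\<dots> = (\<integral>\<theta>. correlation g (rotation \<theta> b) + correlation g (rotation \<theta> c)
      + correlation g (rotation \<theta> (c - b)) \<partial>angle_measure)"
    using g_corr by (simp add: I)
  also have "\<dots> \<le> (\<integral>\<theta>. - W + 3 * (\<epsilon> * W) \<partial>angle_measure)"
    using g_corr upper by (intro integral_mono) auto
  also have "\<dots> = - W + 3 * (\<epsilon> * W)" using angle.prob_space by simp
  finally have "(1 + m - 3 * \<epsilon>) * W \<le> 0" by (simp add: W_eq algebra_simps)
  moreover have "1 + m - 3 * \<epsilon> > 0" using m by (simp add: \<epsilon>_def)
  ultimately show False using W by (simp add: mult_le_0_iff)
qed

section \<open>Triangles and collinear triples\<close>

lemma bdd_below_J0_sum:
  "bdd_below ((\<lambda>t. J0 t + J0 (a * t)) ` T)" "bdd_below ((\<lambda>t. J0 t + J0 (a * t) + J0 (b * t)) ` T)"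
proof -
  have "- 2 \<le> J0 t + J0 (a * t)" "- 3 \<le> J0 t + J0 (a * t) + J0 (b * t)" for t
    using abs_J0_le_1[of t] abs_J0_le_1[of "a * t"] abs_J0_le_1[of "b * t"] by linarith+
  then show "bdd_below ((\<lambda>t. J0 t + J0 (a * t)) ` T)" "bdd_below ((\<lambda>t. J0 t + J0 (a * t) + J0 (b * t)) ` T)"
    by (meson bdd_belowI2)+
qed

text \<open>The assumption controls two of the three sides. For the third side the global minimum of \<open>J0\<close> is used:
it exceeds \<open>- 0.402759398\<close>, and \<open>0.5972406 + 0.402759398 < 1\<close>.\<close>

lemma monochromatic_congruent_triangle:
  fixes A B C :: "real^2"
  assumes "A \<noteq> C" and inf: "(INF t\<in>{0..}. J0 t + J0 (dist A B / dist A C * t)) \<ge> - 0.5972406"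
    and col: "measurable_coloring C1 C2"
  shows "\<exists>A' B' C'. congruent_sets {A, B, C} {A', B', C'} \<and> monochromatic C1 C2 {A', B', C'}"
proof -
  have sides: "- 0.999999998 \<le> J0 (norm (B - A) * t) + J0 (norm (C - A) * t) + J0 (norm (C - A - (B - A)) * t)"
    if "t \<ge> 0" for t
  proof -
    let ?\<omega> = "dist A B / dist A C"
    have "- 0.5972406 \<le> J0 (dist A C * t) + J0 (?\<omega> * (dist A C * t))"
      using that by (intro order_trans[OF inf] cINF_lower bdd_below_J0_sum) auto
    moreover have "?\<omega> * (dist A C * t) = dist A B * t" using \<open>A \<noteq> C\<close> by simp
    ultimately show ?thesis
      using J0_ge[of "norm (C - A - (B - A)) * t"] by (simp add: dist_norm norm_minus_commute)
  qed
  obtain p \<theta> where p: "monochromatic C1 C2 {p, p + rotation \<theta> (B - A), p + rotation \<theta> (C - A)}"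
  proof (rule monochromatic_rotated_copy[OF sides _ col])
    show "(- 1 :: real) < - 0.999999998" by (subst neg_less_iff_less) simp
  qed
  let ?f = "\<lambda>x. p + rotation \<theta> (x - A)"
  have isometry: "dist (?f x) (?f y) = dist x y" for x y
    by (simp add: dist_norm flip: rotation_diff)
  have image: "?f ` {A, B, C} = {p, p + rotation \<theta> (B - A), p + rotation \<theta> (C - A)}" by simp
  have "congruent_sets {A, B, C} {p, p + rotation \<theta> (B - A), p + rotation \<theta> (C - A)}"
    unfolding congruent_sets_def by (rule exI[of _ ?f]) (simp only: isometry image simp_thms)
  with p show ?thesis by blast
qed

text \<open>The three distances in the degenerate triangle \<open>0, e, (1 + \<kappa>) e\<close> are \<open>1\<close>, \<open>\<kappa>\<close> and \<open>1 + \<kappa>\<close>.\<close>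

lemma monochromatic_collinear_triple:
  assumes \<kappa>: "\<kappa> > 0" and inf: "(INF t\<in>{0..}. J0 t + J0 (\<kappa> * t) + J0 ((1 + \<kappa>) * t)) > - 1"
    and col: "measurable_coloring C1 C2"
  shows "\<exists>x y z. y \<in> closed_segment x z \<and> y \<noteq> x \<and> norm (z - y) / norm (y - x) = \<kappa>
    \<and> monochromatic C1 C2 {x, y, z}"
proof -
  define e :: "real^2" where "e = axis 1 1"
  have e: "norm e = 1" by (simp add: e_def)
  have diff: "(1 + \<kappa>) *\<^sub>R e - e = \<kappa> *\<^sub>R e" by (simp add: algebra_simps)
  have "(INF t\<in>{0..}. J0 t + J0 (\<kappa> * t) + J0 ((1 + \<kappa>) * t))
      \<le> J0 (norm e * t) + J0 (norm ((1 + \<kappa>) *\<^sub>R e) * t) + J0 (norm ((1 + \<kappa>) *\<^sub>R e - e) * t)"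
    if "t \<ge> 0" for t
    unfolding diff using that \<kappa> cINF_lower[OF bdd_below_J0_sum(2)[of \<kappa> "1 + \<kappa>" "{0..}"], of t] e
    by (simp add: add_ac)
  from monochromatic_rotated_copy[OF this inf col]
  obtain p \<theta> where "monochromatic C1 C2 {p, p + rotation \<theta> e, p + rotation \<theta> ((1 + \<kappa>) *\<^sub>R e)}"
    by blast
  moreover define u where "u = rotation \<theta> e"
  ultimately have mono: "monochromatic C1 C2 {p, p + u, p + (1 + \<kappa>) *\<^sub>R u}"
    by (simp add: rotation_scaleR)
  have u: "norm u = 1" by (simp add: u_def e)
  have "p + u = (1 - 1 / (1 + \<kappa>)) *\<^sub>R p + (1 / (1 + \<kappa>)) *\<^sub>R (p + (1 + \<kappa>) *\<^sub>R u)"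
  proof -
    have "(1 / (1 + \<kappa>)) *\<^sub>R ((1 + \<kappa>) *\<^sub>R u) = u" using \<kappa> by simp
    then show ?thesis by (simp only: scaleR_add_right scaleR_left_diff_distrib) simp
  qed
  then have seg: "p + u \<in> closed_segment p (p + (1 + \<kappa>) *\<^sub>R u)"
    using \<kappa> unfolding in_segment by (intro exI[of _ "1 / (1 + \<kappa>)"]) simp
  have "p + (1 + \<kappa>) *\<^sub>R u - (p + u) = \<kappa> *\<^sub>R u" by (simp add: algebra_simps)
  then have ratio: "norm (p + (1 + \<kappa>) *\<^sub>R u - (p + u)) / norm (p + u - p) = \<kappa>"
    using \<kappa> u by simp
  have "p + u \<noteq> p" using u by auto
  with seg ratio mono show ?thesis by blast
qed

theorem theorem1:
  shows "(\<forall>(A :: real^2) (B :: real^2) (C :: real^2) (\<omega> :: real).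
           \<not> collinear {A, B, C} \<and> \<omega> = dist A B / dist A C \<and>
           (INF t\<in>{0..}. J0 t + J0 (\<omega> * t)) \<ge> - 0.5972406 \<longrightarrow>
           (\<forall>C1 C2. measurable_coloring C1 C2 \<longrightarrow>
             (\<exists>A' B' C'. congruent_sets {A, B, C} {A', B', C'} \<and>
                monochromatic C1 C2 {A', B', C'})))
       \<and>
         (\<forall>\<kappa> :: real.
           \<kappa> > 0 \<and>
           (INF t\<in>{0..}. J0 t + J0 (\<kappa> * t) + J0 ((1 + \<kappa>) * t)) > - 1 \<longrightarrow>
           (\<forall>C1 C2. measurable_coloring C1 C2 \<longrightarrow>
             (\<exists>x y z. y \<in> closed_segment x z \<and> y \<noteq> x \<and>
                norm (z - y) / norm (y - x) = \<kappa> \<and>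
                monochromatic C1 C2 {x, y, z})))"
proof (intro conjI allI impI)
  fix A B C :: "real^2" and \<omega> :: real and C1 C2
  assume h: "\<not> collinear {A, B, C} \<and> \<omega> = dist A B / dist A C \<and>
      (INF t\<in>{0..}. J0 t + J0 (\<omega> * t)) \<ge> - 0.5972406" and col: "measurable_coloring C1 C2"
  have "A \<noteq> C" using h by (auto simp: insert_commute)
  then show "\<exists>A' B' C'. congruent_sets {A, B, C} {A', B', C'} \<and> monochromatic C1 C2 {A', B', C'}"
    using h col by (intro monochromatic_congruent_triangle) auto
next
  fix \<kappa> :: real and C1 C2
  assume "\<kappa> > 0 \<and> (INF t\<in>{0..}. J0 t + J0 (\<kappa> * t) + J0 ((1 + \<kappa>) * t)) > - 1"
    and "measurable_coloring C1 C2"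
  then show "\<exists>x y z. y \<in> closed_segment x z \<and> y \<noteq> x \<and> norm (z - y) / norm (y - x) = \<kappa> \<and>
      monochromatic C1 C2 {x, y, z}"
    by (intro monochromatic_collinear_triple) auto
qed

end
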